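(* Let $v_F,\hbar,m,\theta>0$, $a<b$ and $V_0\neq0$ be real constants, and let $V(r)=V_0$ for $a<r<b$ and $V(r)=0$ otherwise. Let $M=(n_s,J_s)_{s=0,1,2,3}$ be a piecewise-regular 8-tuple of real-valued functions of $(r,t)\in\mathbb{R}^2$ with $n_0>0$ everywhere. If $M$ is a solution, in the sense of distributions on $\mathbb{R}^2$, of the system (QFDE) with this potential $V$ (see context), then $M$ satisfies the same equations with $V\equiv0$ in the set $\Omega=\{(r,t)\in\mathbb{R}^2: r\neq a,\ r\neq b\}$ (with classical derivatives), together with the jump conditions $$\left\{\begin{aligned}&v_F[J_1]_{r_0}(t)+n_0(r_0,t)[V]_{r_0}=0\\&v_F[J_0]_{r_0}(t)+n_1(r_0,t)[V]_{r_0}=0\\&n_2(r_0,t)=n_3(r_0,t)=0\end{aligned}\right.$$ for $r_0=a,b$ and all $t\in\mathbb{R}$. Conversely, if $M$ satisfies (QFDE) with $V\equiv0$ in $\Omega$ and the jump conditions $v_F[J_1]_{r_0}(t)+n_0(r_0,t)[V]_{r_0}=0$, $v_F[J_0]_{r_0}(t)+n_1(r_0,t)[V]_{r_0}=0$ and $n_2(r_0,t)=n_3(r_0,t)=0$ at $r_0=a,b$ for all $t\in\mathbb R$, then $M$ is a (piecewise-regular) solution of (QFDE) with the given $V$, in the sense of distributions on $\mathbb{R}^2$.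
   Context: The system (QFDE) for real-valued $(n_s,J_s)_{s=0,1,2,3}$ depending on $(r,t)\in\mathbb{R}^2$ is $$\partial_t n_0+v_F\partial_r n_1=0,\qquad \partial_t n_1+v_F\partial_r n_0=0,$$ $$\partial_t n_2+\frac{2v_F}{\hbar}J_3=0,\qquad \partial_t n_3-\frac{2v_F}{\hbar}J_2=0,$$ $$\partial_t J_0+v_F\partial_r J_1+n_0\frac{dV}{dr}=0,\qquad \partial_t J_1+v_F\partial_r J_0+n_1\frac{dV}{dr}=0,$$ $$\partial_t J_2+\frac{2v_F}{\hbar}\Big[\Big(m\theta-\frac{J_0^2}{n_0^2}\Big)n_3+\frac{2}{n_0}J_0J_3\Big]+n_2\frac{dV}{dr}=0,$$ $$\partial_t J_3-\frac{2v_F}{\hbar}\Big[\Big(m\theta-\frac{J_0^2}{n_0^2}\Big)n_2+\frac{2}{n_0}J_0J_2\Big]+n_3\frac{dV}{dr}=0.$$ When $V$ is the barrier, all derivatives are distributional derivatives on $\mathbb{R}^2$, $\frac{dV}{dr}=V_0(\delta(r-a)-\delta(r-b))$, and, for continuous $n_s$, $n_s\frac{dV}{dr}=\sum_{r_0=a,b}n_s(r_0,t)[V]_{r_0}\delta(r-r_0)$, i.e. the distribution $\varphi\mapsto\sum_{r_0=a,b}[V]_{r_0}\int_{\mathbb{R}}n_s(r_0,t)\varphi(r_0,t)\,dt$, where $[V]_a=V_0$, $[V]_b=-V_0$. The space $X\subset L^1_{\mathrm{loc}}(\mathbb{R}^2)$ consists of the functions $u:\mathbb{R}^2\to\mathbb{R}$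 such that $u\in C^1(\Omega)$ and, for every $t_0\in\mathbb{R}$, the limits of $u(r,t)$ as $(r,t)\to(a^-,t_0)$, $(a^+,t_0)$, $(b^-,t_0)$, $(b^+,t_0)$ exist and are finite (where $(r,t)\to(a^-,t_0)$ means $r<a$, $r\to a$, $t\to t_0$, and similarly for the others). For $u\in X$ (or $u=V$) the jump of $u$ in $r_0$ is $[u]_{r_0}(t)=\lim_{r\to r_0^+}u(r,t)-\lim_{r\to r_0^-}u(r,t)$. An 8-tuple $(n_s,J_s)_{s=0,1,2,3}$ of real-valued functions on $\mathbb{R}^2$ is piecewise-regular if, for $s=0,1,2,3$, $n_s\in C(\mathbb{R}^2)$, $\frac{\partial n_s}{\partial r}\in X$ (derivative taken in $\Omega$, i.e. almost everywhere), and $J_s\in X$. *)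

theory Defs
  imports "HOL-Analysis.Analysis"
begin

text \<open>Meant for open \<open>S\<close>, where the derivative \<open>f'\<close> is unique.\<close>

primrec Ck_on :: "nat \<Rightarrow> 'a::real_normed_vector set \<Rightarrow> ('a \<Rightarrow> 'b::real_normed_vector) \<Rightarrow> bool" where
  "Ck_on 0 S f \<longleftrightarrow> continuous_on S f"
| "Ck_on (Suc k) S f \<longleftrightarrow>
     (\<exists>f'. (\<forall>z\<in>S. (f has_derivative f' z) (at z)) \<and> (\<forall>v. Ck_on k S (\<lambda>z. f' z v)))"

text \<open>Points of the plane are pairs \<open>(r, t)\<close>. The operators below are the classical partial
  derivatives; since \<^const>\<open>deriv\<close> is total, existence is always required separately.\<close>

definition pd_r :: "(real \<times> real \<Rightarrow> real) \<Rightarrow> real \<times> real \<Rightarrow> real" where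
  "pd_r u z = deriv (\<lambda>r. u (r, snd z)) (fst z)"

definition pd_t :: "(real \<times> real \<Rightarrow> real) \<Rightarrow> real \<times> real \<Rightarrow> real" where
  "pd_t u z = deriv (\<lambda>t. u (fst z, t)) (snd z)"

definition differentiable_r :: "(real \<times> real \<Rightarrow> real) \<Rightarrow> real \<times> real \<Rightarrow> bool" where
  "differentiable_r u z \<longleftrightarrow> (\<lambda>r. u (r, snd z)) differentiable (at (fst z))"

definition differentiable_t :: "(real \<times> real \<Rightarrow> real) \<Rightarrow> real \<times> real \<Rightarrow> bool" where
  "differentiable_t u z \<longleftrightarrow> (\<lambda>t. u (fst z, t)) differentiable (at (snd z))"

definition Omega :: "real \<Rightarrow> real \<Rightarrow> (real \<times> real) set" where
  "Omega a b = {(r, t). r \<noteq> a \<and> r \<noteq> b}"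

definition barrier :: "real \<Rightarrow> real \<Rightarrow> real \<Rightarrow> real \<Rightarrow> real" where
  "barrier a b V0 r = (if a < r \<and> r < b then V0 else 0)"

definition left_of :: "real \<Rightarrow> real \<Rightarrow> (real \<times> real) filter" where
  "left_of r0 t0 = at (r0, t0) within {..<r0} \<times> UNIV"

definition right_of :: "real \<Rightarrow> real \<Rightarrow> (real \<times> real) filter" where
  "right_of r0 t0 = at (r0, t0) within {r0<..} \<times> UNIV"

text \<open>Elements of \<open>X\<close> may take arbitrary values on the lines \<open>r = a\<close> and \<open>r = b\<close>, so they need
  not be Borel measurable; hence integrals over the plane are taken with respect to
  \<^const>\<open>lebesgue\<close>, in which null sets are measurable.\<close>

definition space_X :: "real \<Rightarrow> real \<Rightarrow> (real \<times> real \<Rightarrow> real) set" where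
  "space_X a b = {u. (\<forall>K. compact K \<longrightarrow> u absolutely_integrable_on K)
     \<and> Ck_on 1 (Omega a b) u
     \<and> (\<forall>r0\<in>{a, b}. \<forall>t0. (\<exists>l. (u \<longlongrightarrow> l) (left_of r0 t0)) \<and> (\<exists>l. (u \<longlongrightarrow> l) (right_of r0 t0)))}"

definition jump :: "(real \<times> real \<Rightarrow> real) \<Rightarrow> real \<Rightarrow> real \<Rightarrow> real" where
  "jump u r0 t = Lim (right_of r0 t) u - Lim (left_of r0 t) u"

definition jump_pot :: "(real \<Rightarrow> real) \<Rightarrow> real \<Rightarrow> real" where
  "jump_pot V r0 = Lim (at_right r0) V - Lim (at_left r0) V"

lemma jump_pot_barrier:
  assumes "a < b"
  shows "jump_pot (barrier a b V0) a = V0" and "jump_pot (barrier a b V0) b = - V0"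
proof -
  have ar: "(barrier a b V0 \<longlongrightarrow> V0) (at_right a)"
    by (rule tendsto_eventually, rule eventually_at_rightI[of a b])
       (use assms in \<open>auto simp: barrier_def\<close>)
  have al: "(barrier a b V0 \<longlongrightarrow> 0) (at_left a)"
    by (rule tendsto_eventually, rule eventually_at_leftI[of "a - 1" a])
       (auto simp: barrier_def)
  have br: "(barrier a b V0 \<longlongrightarrow> 0) (at_right b)"
    by (rule tendsto_eventually, rule eventually_at_rightI[of b "b + 1"])
       (auto simp: barrier_def)
  have bl: "(barrier a b V0 \<longlongrightarrow> V0) (at_left b)"
    by (rule tendsto_eventually, rule eventually_at_leftI[of a b])
       (use assms in \<open>auto simp: barrier_def\<close>)
  show "jump_pot (barrier a b V0) a = V0"
    by (simp add: jump_pot_def tendsto_Lim[OF _ ar] tendsto_Lim[OF _ al])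
  show "jump_pot (barrier a b V0) b = - V0"
    by (simp add: jump_pot_def tendsto_Lim[OF _ br] tendsto_Lim[OF _ bl])
qed

text \<open>The 8-tuple \<open>(n\<^sub>s, J\<^sub>s)\<close> is a pair of families indexed by natural numbers, of which only the
  indices \<open>0, 1, 2, 3\<close> are used.\<close>

definition piecewise_regular ::
  "real \<Rightarrow> real \<Rightarrow> (nat \<Rightarrow> real \<times> real \<Rightarrow> real) \<Rightarrow> (nat \<Rightarrow> real \<times> real \<Rightarrow> real) \<Rightarrow> bool" where
  "piecewise_regular a b n J \<longleftrightarrow>
     (\<forall>s\<in>{0, 1, 2, 3}. continuous_on UNIV (n s)
        \<and> (\<forall>z\<in>Omega a b. differentiable_r (n s) z) \<and> pd_r (n s) \<in> space_X a b
        \<and> J s \<in> space_X a b)"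

definition classical_QFDE ::
  "real \<Rightarrow> real \<Rightarrow> real \<Rightarrow> real \<Rightarrow> (real \<Rightarrow> real) \<Rightarrow> (real \<times> real) set
     \<Rightarrow> (nat \<Rightarrow> real \<times> real \<Rightarrow> real) \<Rightarrow> (nat \<Rightarrow> real \<times> real \<Rightarrow> real) \<Rightarrow> bool" where
  "classical_QFDE vF hbar m \<theta> V S n J \<longleftrightarrow>
     (\<forall>z\<in>S.
        V differentiable (at (fst z))
      \<and> (\<forall>s\<in>{0, 1, 2, 3}. differentiable_t (n s) z \<and> differentiable_t (J s) z)
      \<and> (\<forall>s\<in>{0, 1}. differentiable_r (n s) z \<and> differentiable_r (J s) z)
      \<and> pd_t (n 0) z + vF * pd_r (n 1) z = 0
      \<and> pd_t (n 1) z + vF * pd_r (n 0) z = 0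
      \<and> pd_t (n 2) z + 2 * vF / hbar * J 3 z = 0
      \<and> pd_t (n 3) z - 2 * vF / hbar * J 2 z = 0
      \<and> pd_t (J 0) z + vF * pd_r (J 1) z + n 0 z * deriv V (fst z) = 0
      \<and> pd_t (J 1) z + vF * pd_r (J 0) z + n 1 z * deriv V (fst z) = 0
      \<and> pd_t (J 2) z + 2 * vF / hbar * ((m * \<theta> - (J 0 z)\<^sup>2 / (n 0 z)\<^sup>2) * n 3 z
          + 2 / n 0 z * J 0 z * J 3 z) + n 2 z * deriv V (fst z) = 0
      \<and> pd_t (J 3) z - 2 * vF / hbar * ((m * \<theta> - (J 0 z)\<^sup>2 / (n 0 z)\<^sup>2) * n 2 z
          + 2 / n 0 z * J 0 z * J 2 z) + n 3 z * deriv V (fst z) = 0)"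

type_synonym distribution = "(real \<times> real \<Rightarrow> real) \<Rightarrow> real"

definition test_function :: "(real \<times> real \<Rightarrow> real) \<Rightarrow> bool" where
  "test_function \<phi> \<longleftrightarrow> (\<forall>k. Ck_on k UNIV \<phi>) \<and> compact (closure {z. \<phi> z \<noteq> 0})"

definition dist_of :: "(real \<times> real \<Rightarrow> real) \<Rightarrow> distribution" where
  "dist_of u \<phi> = (LINT z|lebesgue. u z * \<phi> z)"

definition D_r :: "distribution \<Rightarrow> distribution" where
  "D_r T \<phi> = - T (pd_r \<phi>)"

definition D_t :: "distribution \<Rightarrow> distribution" where
  "D_t T \<phi> = - T (pd_t \<phi>)"

text \<open>The product of a continuous function with \<open>dV/dr = V\<^sub>0 (\<delta>(r - a) - \<delta>(r - b))\<close>, regarded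
  as a distribution on the plane.\<close>

definition times_dV :: "real \<Rightarrow> real \<Rightarrow> real \<Rightarrow> (real \<times> real \<Rightarrow> real) \<Rightarrow> distribution" where
  "times_dV a b V0 u \<phi> =
     (\<Sum>r0\<in>{a, b}. jump_pot (barrier a b V0) r0 * (LINT t|lborel. u (r0, t) * \<phi> (r0, t)))"

definition distributional_QFDE ::
  "real \<Rightarrow> real \<Rightarrow> real \<Rightarrow> real \<Rightarrow> real \<Rightarrow> real \<Rightarrow> real
     \<Rightarrow> (nat \<Rightarrow> real \<times> real \<Rightarrow> real) \<Rightarrow> (nat \<Rightarrow> real \<times> real \<Rightarrow> real) \<Rightarrow> bool" where
  "distributional_QFDE vF hbar m \<theta> a b V0 n J \<longleftrightarrow>
     (\<forall>\<phi>. test_function \<phi> \<longrightarrow>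
        D_t (dist_of (n 0)) \<phi> + vF * D_r (dist_of (n 1)) \<phi> = 0
      \<and> D_t (dist_of (n 1)) \<phi> + vF * D_r (dist_of (n 0)) \<phi> = 0
      \<and> D_t (dist_of (n 2)) \<phi> + 2 * vF / hbar * dist_of (J 3) \<phi> = 0
      \<and> D_t (dist_of (n 3)) \<phi> - 2 * vF / hbar * dist_of (J 2) \<phi> = 0
      \<and> D_t (dist_of (J 0)) \<phi> + vF * D_r (dist_of (J 1)) \<phi> + times_dV a b V0 (n 0) \<phi> = 0
      \<and> D_t (dist_of (J 1)) \<phi> + vF * D_r (dist_of (J 0)) \<phi> + times_dV a b V0 (n 1) \<phi> = 0
      \<and> D_t (dist_of (J 2)) \<phi>
          + 2 * vF / hbar * dist_of (\<lambda>z. (m * \<theta> - (J 0 z)\<^sup>2 / (n 0 z)\<^sup>2) * n 3 z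
              + 2 / n 0 z * J 0 z * J 3 z) \<phi>
          + times_dV a b V0 (n 2) \<phi> = 0
      \<and> D_t (dist_of (J 3)) \<phi>
          - 2 * vF / hbar * dist_of (\<lambda>z. (m * \<theta> - (J 0 z)\<^sup>2 / (n 0 z)\<^sup>2) * n 2 z
              + 2 / n 0 z * J 0 z * J 2 z) \<phi>
          + times_dV a b V0 (n 3) \<phi> = 0)"

end

theory Submission
  imports Defs
begin

text \<open>
  All eight equations have the form \<open>\<partial>\<^sub>t P + c \<partial>\<^sub>r Q + k g + N dV/dr = 0\<close> with \<open>P\<close>, \<open>Q\<close>, \<open>g\<close> continuous
  up to the boundary on each of the three strips cut out by \<open>r = a\<close> and \<open>r = b\<close>. If the equation
  holds classically off the two lines, Green's formula on the strips turns the distributional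
  left-hand side into the line integrals of \<open>(c [Q] + N [V]) \<phi>\<close>, which vanish for all \<open>\<phi>\<close> iff the jump
  conditions hold. Conversely, testing with products \<open>\<alpha>(r) \<beta>(t)\<close> supported off the lines
  and removing \<open>\<alpha>\<close> by the fundamental lemma reduces the classical equation to the
  du Bois-Reymond lemma in the variable \<open>t\<close>, which also yields the differentiability of \<open>P\<close> in \<open>t\<close>.
\<close>

section \<open>Smooth bump functions\<close>

text \<open>The equations differ in which terms are absent, and this decides the jump conditions.
  Where \<open>Q\<close> is one of the continuous \<open>n s\<close>, its jump is zero and nothing
  survives on the lines; where \<open>Q\<close> is absent but \<open>N\<close> is present, the
  condition degenerates to \<open>N [V] = 0\<close>, which \<open>V0 \<noteq> 0\<close> turns into
  \<open>n 2 = n 3 = 0\<close>. Two obstacles shape the proof. The \<open>n s\<close> are assumed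
  continuous with a regular derivative in \<open>r\<close> only, so their derivative in
  \<open>t\<close> has to be produced by the equation itself. And membership in
  \<open>space_X\<close> bounds neither the first derivatives near the lines nor the values on them:
  integrals up to the lines are therefore taken of continuous representatives on each strip, and
  derivatives of the unknowns enter only in the interior.\<close>

lemma Ck_on_SucD: "Ck_on (Suc k) S f \<Longrightarrow> Ck_on k S f"
proof (induction k arbitrary: f)
  case 0
  then show ?case
    by (auto intro!: continuous_at_imp_continuous_on intro: has_derivative_continuous)
next
  case (Suc k)
  from Suc.prems obtain f' where "\<forall>z\<in>S. (f has_derivative f' z) (at z)"
    "\<forall>v. Ck_on (Suc k) S (\<lambda>z. f' z v)"
    unfolding Ck_on.simps(2)[of "Suc k"] by blast
  with Suc.IH show ?case by (simp only: Ck_on.simps) blast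
qed

lemma Ck_on_add:
  "Ck_on k S f \<Longrightarrow> Ck_on k S g \<Longrightarrow> Ck_on k S (\<lambda>z. f z + g z)"
proof (induction k arbitrary: f g)
  case 0
  then show ?case by (auto intro: continuous_intros)
next
  case (Suc k)
  then obtain f' g' where f': "\<forall>z\<in>S. (f has_derivative f' z) (at z)" "\<forall>v. Ck_on k S (\<lambda>z. f' z v)"
    and g': "\<forall>z\<in>S. (g has_derivative g' z) (at z)" "\<forall>v. Ck_on k S (\<lambda>z. g' z v)" by auto
  show ?case unfolding Ck_on.simps
    by (rule exI[of _ "\<lambda>z v. f' z v + g' z v"])
       (use f' g' Suc.IH in \<open>auto intro: has_derivative_add\<close>)
qed

lemma Ck_on_const: "Ck_on k S (\<lambda>z. c)"
proof (induction k arbitrary: c)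
  case (Suc k)
  then show ?case by (auto intro!: exI[of _ "\<lambda>z v. 0"])
qed auto

lemma Ck_on_mult:
  fixes f g :: "'a::real_normed_vector \<Rightarrow> 'b::real_normed_algebra"
  shows "Ck_on k S f \<Longrightarrow> Ck_on k S g \<Longrightarrow> Ck_on k S (\<lambda>z. f z * g z)"
proof (induction k arbitrary: f g)
  case 0
  then show ?case by (auto intro: continuous_intros)
next
  case (Suc k)
  then obtain f' g' where f': "\<forall>z\<in>S. (f has_derivative f' z) (at z)" "\<forall>v. Ck_on k S (\<lambda>z. f' z v)"
    and g': "\<forall>z\<in>S. (g has_derivative g' z) (at z)" "\<forall>v. Ck_on k S (\<lambda>z. g' z v)" by auto
  have "Ck_on k S f" "Ck_on k S g" using Suc.prems Ck_on_SucD by blast+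
  then show ?case unfolding Ck_on.simps
    by (intro exI[of _ "\<lambda>z v. f z * g' z v + f' z v * g z"])
       (use f' g' Suc.IH in \<open>auto intro: has_derivative_mult Ck_on_add\<close>)
qed

text \<open>The derivative in direction \<open>v\<close> is \<open>f' (l z + c) (l v)\<close>, a
  directional derivative of \<open>f\<close> in the fixed direction \<open>l v\<close>, composed
  with the same affine map. So the induction closes without a chain rule of order \<open>k\<close>.
  Translations, reflections and the coordinate projections are all of this form.\<close>

lemma Ck_on_compose_affine:
  assumes l: "bounded_linear l"
  shows "Ck_on k UNIV f \<Longrightarrow> Ck_on k UNIV (\<lambda>z. f (l z + c))"
proof (induction k arbitrary: f)
  case 0
  then show ?case using bounded_linear.continuous_on[OF l continuous_on_id]
    by (auto intro!: continuous_on_compose2[of UNIV f] continuous_intros)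
next
  case (Suc k)
  then obtain f' where f': "\<And>z. (f has_derivative f' z) (at z)" "\<And>v. Ck_on k UNIV (\<lambda>z. f' z v)"
    by auto
  have "((\<lambda>z. l z + c) has_derivative l) (at z)" for z
    using bounded_linear.has_derivative[OF l has_derivative_ident]
    by (auto intro!: derivative_eq_intros)
  then have "((\<lambda>z. f (l z + c)) has_derivative (\<lambda>v. f' (l z + c) (l v))) (at z)" for z
    using has_derivative_compose f'(1) by blast
  then show ?case unfolding Ck_on.simps
    by (intro exI[of _ "\<lambda>z v. f' (l z + c) (l v)"]) (use f' Suc.IH in auto)
qed

lemma Ck_on_Suc_real:
  fixes f :: "real \<Rightarrow> real"
  assumes "\<And>x. x \<in> S \<Longrightarrow> (f has_real_derivative g x) (at x)" "Ck_on k S g"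
  shows "Ck_on (Suc k) S f"
  unfolding Ck_on.simps
  by (rule exI[of _ "\<lambda>x v. g x * v"])
     (use assms in \<open>auto simp: has_field_derivative_def intro: Ck_on_mult Ck_on_const\<close>)

text \<open>The classical function \<open>exp (- 1/x)\<close>, flat at the origin, is
  \<open>flat 1\<close>. The polynomial factor in \<open>1 / x\<close> makes the family closed under
  differentiation, so one induction shows all its members smooth.\<close>

definition flat :: "real poly \<Rightarrow> real \<Rightarrow> real" where
  "flat p x = (if x > 0 then poly p (1 / x) * exp (- (1 / x)) else 0)"

lemma poly_over_exp_tendsto_0: "((\<lambda>y::real. poly p y * exp (- y)) \<longlongrightarrow> 0) at_top"
proof -
  have "((\<lambda>y. \<Sum>i\<le>degree p. coeff p i * (y ^ i / exp y)) \<longlongrightarrow> (\<Sum>i\<le>degree p. coeff p i * 0)) at_top"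
    by (intro tendsto_intros tendsto_power_div_exp_0)
  then show ?thesis
    by (simp add: poly_altdef sum_distrib_right exp_minus field_simps sum_divide_distrib)
qed

lemma flat_tendsto_0: "(flat p \<longlongrightarrow> 0) (at_right 0)"
proof -
  have "((\<lambda>x. poly p (inverse x) * exp (- inverse x)) \<longlongrightarrow> 0) (at_right (0::real))"
    by (rule filterlim_compose[OF poly_over_exp_tendsto_0 filterlim_inverse_at_top_right])
  moreover have "\<forall>\<^sub>F x in at_right 0. poly p (inverse x) * exp (- inverse x) = flat p x"
    by (auto simp: flat_def eventually_at_filter inverse_eq_divide)
  ultimately show ?thesis by (simp cong: tendsto_cong)
qed

text \<open>With \<open>y = 1/x\<close> one has \<open>dy/dx = - y^2\<close>, so
  \<open>p(y) exp(-y)\<close> has the derivative \<open>y^2 (p(y) - p'(y)) exp(-y)\<close>; the two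
  \<open>pCons 0\<close> are the factor \<open>y^2\<close>.\<close>

lemma flat_has_derivative:
  "(flat p has_real_derivative flat (pCons 0 (pCons 0 (p - pderiv p))) x) (at x)"
proof (cases x "0::real" rule: linorder_cases)
  case less
  have "((\<lambda>_. 0) has_real_derivative 0) (at x)" by simp
  then show ?thesis
    by (rule has_field_derivative_transform_within_open[where S="{..<0}", THEN DERIV_cong])
       (use less in \<open>auto simp: flat_def\<close>)
next
  case equal
  have "((\<lambda>h. (flat p (0 + h) - flat p 0) / h) \<longlongrightarrow> 0) (at 0)"
  proof (rule filterlim_split_at_real)
    have "\<forall>\<^sub>F h in at_left 0. 0 = (flat p (0 + h) - flat p 0) / h"
      by (auto simp: flat_def eventually_at_filter)
    then show "((\<lambda>h. (flat p (0 + h) - flat p 0) / h) \<longlongrightarrow> 0) (at_left 0)"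
      by (rule Lim_transform_eventually[OF tendsto_const])
    \<comment> \<open>Division by \<open>h\<close> adds one factor \<open>1 / h\<close>, so the
      right difference quotient is again a flat function and tends to 0.\<close>
    have "\<forall>\<^sub>F h in at_right 0. flat (pCons 0 p) h = (flat p (0 + h) - flat p 0) / h"
      by (auto simp: flat_def eventually_at_filter)
    then show "((\<lambda>h. (flat p (0 + h) - flat p 0) / h) \<longlongrightarrow> 0) (at_right 0)"
      by (rule Lim_transform_eventually[OF flat_tendsto_0])
  qed
  then show ?thesis using equal by (simp add: DERIV_def flat_def)
next
  case greater
  have "((\<lambda>x. poly p (1 / x) * exp (- (1 / x))) has_real_derivative
      flat (pCons 0 (pCons 0 (p - pderiv p))) x) (at x)"
    using greater
    by (auto intro!: derivative_eq_intros DERIV_chain2[OF poly_DERIV]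
        simp: flat_def field_simps power2_eq_square)
  then show ?thesis
    by (rule has_field_derivative_transform_within_open[where S="{0<..}"])
       (use greater in \<open>auto simp: flat_def\<close>)
qed

lemma flat_Ck: "Ck_on k UNIV (flat p)"
proof (induction k arbitrary: p)
  case 0
  then show ?case by (auto intro!: DERIV_continuous_on[OF flat_has_derivative[THEN has_field_derivative_at_within]])
next
  case (Suc k)
  then show ?case by (intro Ck_on_Suc_real[OF flat_has_derivative])
qed

text \<open>The left factor vanishes for \<open>x \<le> c - e\<close>, the right one for
  \<open>x \<ge> c + e\<close>. Only sign, support and behaviour under translation are used, hence
  no normalisation.\<close>

definition bump :: "real \<Rightarrow> real \<Rightarrow> real \<Rightarrow> real" where
  "bump e c x = flat 1 (x - c + e) * flat 1 (c + e - x)"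

lemma bump_Ck: "Ck_on k UNIV (bump e c)"
proof -
  have "bump e c = (\<lambda>x. flat 1 (x + (e - c)) * flat 1 (- x + (c + e)))"
    by (auto simp: bump_def algebra_simps)
  then show ?thesis
    by (simp only:) (intro Ck_on_mult Ck_on_compose_affine flat_Ck bounded_linear_ident bounded_linear_minus)
qed

lemma bump_pos: "\<bar>x - c\<bar> < e \<Longrightarrow> bump e c x > 0"
  by (auto simp: bump_def flat_def)

lemma bump_zero: "\<bar>x - c\<bar> \<ge> e \<Longrightarrow> bump e c x = 0"
  by (auto simp: bump_def flat_def)

lemma bump_nonneg: "bump e c x \<ge> 0"
  using bump_pos bump_zero by (metis le_less not_le)

lemma bump_continuous: "continuous_on S (bump e c)"
  using bump_Ck[of 0 e c] by (auto intro: continuous_on_subset)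

text \<open>Bumps of equal width are translates of one another and so have equal mass; this is why
  the difference of two of them has a compactly supported primitive.\<close>

lemma bump_shift: "bump e c x = bump e 0 (x - c)"
  by (auto simp: bump_def algebra_simps)

section \<open>Fundamental lemmas of the calculus of variations\<close>

text \<open>If \<open>w x0 \<noteq> 0\<close>, then \<open>w\<close> keeps its sign near
  \<open>x0\<close>; against a narrow bump the integrand has one sign and is nonzero at
  \<open>x0\<close>, so its integral cannot vanish. The conclusion concerns \<open>x0\<close> alone,
  so bumps centred there suffice as tests.\<close>

lemma fundamental_lemma_real:
  fixes w :: "real \<Rightarrow> real"
  assumes w: "continuous_on {c..d} w" and x0: "c < x0" "x0 < d"
    and int0: "\<And>e. e > 0 \<Longrightarrow> c < x0 - e \<Longrightarrow> x0 + e < d \<Longrightarrow> integral {c..d} (\<lambda>x. w x * bump e x0 x) = 0"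
  shows "w x0 = 0"
proof (rule ccontr)
  assume neq: "w x0 \<noteq> 0"
  define v where "v x = sgn (w x0) * w x" for x
  have v: "continuous_on {c..d} v" unfolding v_def using w by (intro continuous_intros)
  have v0: "v x0 > 0" using neq by (simp add: v_def sgn_mult_self_eq flip: abs_sgn add: mult.commute)
  have "isCont v x0" using v x0 by (auto intro: continuous_on_interior)
  then have "\<forall>\<^sub>F x in at x0. v x > 0" using v0 by (auto simp: isCont_def intro: order_tendstoD)
  then obtain e1 where e1: "e1 > 0" "\<And>x. \<bar>x - x0\<bar> < e1 \<Longrightarrow> v x > 0"
    using v0 unfolding eventually_at by (metis dist_real_def UNIV_I)
  \<comment> \<open>Narrow enough for the sign of \<open>v\<close>; the halved distances keep the
    inequalities demanded by \<open>int0\<close> strict.\<close>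
  define e where "e = Min {e1, (x0 - c) / 2, (d - x0) / 2}"
  have e: "e > 0" "e \<le> e1" "c < x0 - e" "x0 + e < d" using e1 x0 by (auto simp: e_def min_def field_simps)
  have "integral {c..d} (\<lambda>x. v x * bump e x0 x) = 0"
    using int0[OF e(1,3,4)] by (simp add: v_def mult.assoc)
  moreover have "v x * bump e x0 x \<ge> 0" for x
    using e1(2)[of x] e(2) bump_zero[of e x x0] bump_nonneg[of e x0 x] by (cases "\<bar>x - x0\<bar> < e") auto
  moreover have "continuous_on {c..d} (\<lambda>x. v x * bump e x0 x)"
    by (intro continuous_intros v bump_continuous)
  ultimately have "v x0 * bump e x0 x0 = 0"
    using integral_eq_0_iff[of c d "\<lambda>x. v x * bump e x0 x"] x0 by simp
  then show False using v0 bump_pos[of x0 x0 e] e by auto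
qed

lemma antiderivative_exists:
  fixes q :: "real \<Rightarrow> real"
  assumes "continuous_on UNIV q"
  obtains H where "\<And>x. (H has_real_derivative q x) (at x)"
proof -
  have "\<exists>F. \<forall>x. -\<infinity> < ereal x \<longrightarrow> ereal x < \<infinity> \<longrightarrow> (F has_vector_derivative q x) (at x)"
    using assms by (intro einterval_antiderivative) (auto simp: continuous_on_eq_continuous_at)
  then show ?thesis using that by (auto simp: has_real_derivative_iff_has_vector_derivative)
qed

text \<open>A primitive \<open>B\<close> of the centred bump is constant on either side of the
  support. Its translates to \<open>t1\<close> and \<open>t2\<close> share these two constants, so
  their difference vanishes beyond both supports, without any integral being computed.\<close>

lemma bump_difference_primitive:
  assumes "e > 0" "\<bar>t1\<bar> + e < R" "\<bar>t2\<bar> + e < R"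
  obtains \<beta> where "\<And>t. (\<beta> has_real_derivative bump e t1 t - bump e t2 t) (at t)"
    "\<And>k. Ck_on k UNIV \<beta>" "\<And>t. \<bar>t\<bar> \<ge> R \<Longrightarrow> \<beta> t = 0"
proof -
  obtain B where B: "\<And>x. (B has_real_derivative bump e 0 x) (at x)"
    using antiderivative_exists[OF bump_continuous] by blast
  define \<beta> where "\<beta> t = B (t - t1) - B (t - t2)" for t
  have der: "(\<beta> has_real_derivative bump e t1 t - bump e t2 t) (at t)" for t
    unfolding \<beta>_def bump_shift[of e t1] bump_shift[of e t2]
    by (auto intro!: derivative_eq_intros DERIV_chain2[OF B])
  have BL: "B x = B (-e)" if "x \<le> -e" for x
  proof -
    have "(B has_real_derivative 0) (at y)" if "y \<le> -e" for y
      using B[of y] bump_zero[of e y 0] that assms by auto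
    then show ?thesis
      using has_field_derivative_zero_constant[of "{..-e}" B] that
      by (metis atMost_iff convex_real_interval(2) has_field_derivative_at_within order_refl)
  qed
  have BR: "B x = B e" if "x \<ge> e" for x
  proof -
    have "(B has_real_derivative 0) (at y)" if "y \<ge> e" for y
      using B[of y] bump_zero[of e y 0] that assms by auto
    then show ?thesis
      using has_field_derivative_zero_constant[of "{e..}" B] that
      by (metis atLeast_iff convex_real_interval(1) has_field_derivative_at_within order_refl)
  qed
  have "\<beta> t = 0" if "\<bar>t\<bar> \<ge> R" for t
  proof (cases "t \<ge> 0")
    case True
    then show ?thesis using that assms BR[of "t - t1"] BR[of "t - t2"] by (auto simp: \<beta>_def)
  next
    case False
    then show ?thesis using that assms BL[of "t - t1"] BL[of "t - t2"] by (auto simp: \<beta>_def)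
  qed
  moreover have "Ck_on k UNIV \<beta>" for k
  proof -
    have "Ck_on k UNIV (\<lambda>t. bump e t1 t + (-1) * bump e t2 t)" for k
      by (intro Ck_on_add Ck_on_mult Ck_on_const bump_Ck)
    then have "Ck_on (Suc k) UNIV \<beta>" using der by (intro Ck_on_Suc_real) auto
    then show ?thesis by (rule Ck_on_SucD)
  qed
  ultimately show ?thesis using that der by blast
qed

lemma integral_by_parts_compact:
  fixes f g :: "real \<Rightarrow> real"
  assumes "c \<le> d" "continuous_on {c..d} f" "continuous_on {c..d} g"
    and "\<And>t. t \<in> {c<..<d} \<Longrightarrow> (f has_real_derivative f' t) (at t)"
    and "\<And>t. t \<in> {c<..<d} \<Longrightarrow> (g has_real_derivative g' t) (at t)"
    and "g c = 0" "g d = 0"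
  shows "((\<lambda>t. f t * g' t + f' t * g t) has_integral 0) {c..d}"
proof -
  have "((\<lambda>t. f t * g' t + f' t * g t) has_integral (f d * g d - f c * g c)) {c..d}"
    using assms
    by (intro fundamental_theorem_of_calculus_interior)
       (auto intro!: continuous_intros derivative_eq_intros
         simp flip: has_real_derivative_iff_has_vector_derivative)
  then show ?thesis using assms by simp
qed

text \<open>For a primitive \<open>H\<close> of \<open>q\<close>, integration by parts turns the
  hypothesis into orthogonality of \<open>p - H\<close> to the derivatives of all test functions. If
  \<open>p - H\<close> took different values at \<open>t1\<close> and \<open>t2\<close>, the
  difference of two bumps at these points would be such a derivative with a nonzero pairing. So
  \<open>p - H\<close> is constant, and \<open>p\<close> inherits the derivative of
  \<open>H\<close>.\<close>

lemma du_Bois_Reymond: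
  fixes p q :: "real \<Rightarrow> real"
  assumes p: "continuous_on UNIV p" and q: "continuous_on UNIV q"
    and weak: "\<And>\<beta> \<beta>' R. \<lbrakk>R > 0; \<And>k. Ck_on k UNIV \<beta>; \<And>t. (\<beta> has_real_derivative \<beta>' t) (at t);
        \<And>t. \<bar>t\<bar> \<ge> R \<Longrightarrow> \<beta> t = 0\<rbrakk> \<Longrightarrow> integral {-R..R} (\<lambda>t. p t * \<beta>' t + q t * \<beta> t) = 0"
  shows "(p has_real_derivative q t) (at t)"
proof -
  obtain H where H: "\<And>x. (H has_real_derivative q x) (at x)"
    using antiderivative_exists[OF q] by blast
  have contH: "continuous_on S H" for S
    by (rule DERIV_continuous_on[OF has_field_derivative_at_within[OF H]])
  have le: "p t1 - H t1 \<le> p t2 - H t2" for t1 t2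
  proof (rule ccontr)
    define f where "f t = p t - H t" for t
    assume "\<not> ?thesis"
    then have lt: "f t2 < f t1" by (simp add: f_def)
    \<comment> \<open>A level strictly between the two values: \<open>f - k\<close> is positive near
      \<open>t1\<close> and negative near \<open>t2\<close>, so both bumps contribute with the same
      sign.\<close>
    define k where "k = (f t1 + f t2) / 2"
    have k: "f t2 < k" "k < f t1" using lt by (auto simp: k_def)
    have contf: "continuous_on S f" for S
      unfolding f_def using p contH by (intro continuous_intros) (auto intro: continuous_on_subset)
    have cf: "isCont f x" for x
      using contf[of UNIV] continuous_on_eq_continuous_at[OF open_UNIV, of f] by blast
    have "\<forall>\<^sub>F x in at t1. f x > k" using cf[of t1] k by (auto simp: isCont_def intro: order_tendstoD)
    then obtain e1 where e1: "e1 > 0" "\<And>x. \<bar>x - t1\<bar> < e1 \<Longrightarrow> f x > k"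
      using k unfolding eventually_at by (metis dist_real_def UNIV_I)
    have "\<forall>\<^sub>F x in at t2. f x < k" using cf[of t2] k by (auto simp: isCont_def intro: order_tendstoD)
    then obtain e2 where e2: "e2 > 0" "\<And>x. \<bar>x - t2\<bar> < e2 \<Longrightarrow> f x < k"
      using k unfolding eventually_at by (metis dist_real_def UNIV_I)
    define e where "e = min e1 e2"
    have e: "e > 0" "e \<le> e1" "e \<le> e2" using e1 e2 by (auto simp: e_def)
    define R where "R = \<bar>t1\<bar> + \<bar>t2\<bar> + e + 1"
    have R: "\<bar>t1\<bar> + e < R" "\<bar>t2\<bar> + e < R" "R > 0" using e by (auto simp: R_def)
    obtain \<beta> where \<beta>: "\<And>t. (\<beta> has_real_derivative bump e t1 t - bump e t2 t) (at t)"
      "\<And>k. Ck_on k UNIV \<beta>" "\<And>t. \<bar>t\<bar> \<ge> R \<Longrightarrow> \<beta> t = 0"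
      using bump_difference_primitive[OF e(1) R(1,2)] by blast
    let ?b = "\<lambda>t. bump e t1 t - bump e t2 t"
    have cont\<beta>: "continuous_on S \<beta>" for S
      by (rule DERIV_continuous_on[OF has_field_derivative_at_within[OF \<beta>(1)]])
    have 1: "integral {-R..R} (\<lambda>t. p t * ?b t + q t * \<beta> t) = 0"
      by (rule weak) (use \<beta> R in auto)
    have "continuous_on {-R..R} (\<lambda>t. p t * ?b t + q t * \<beta> t)"
      using p q by (intro continuous_intros bump_continuous cont\<beta>) (auto intro: continuous_on_subset)
    then have "((\<lambda>t. p t * ?b t + q t * \<beta> t) has_integral 0) {-R..R}"
      using 1 by (metis integrable_continuous_real integrable_integral)
    \<comment> \<open>By parts, as \<open>\<beta>\<close> vanishes at both ends; the constant
      \<open>k\<close> is free because \<open>?b\<close> is the derivative of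
      \<open>\<beta>\<close>.\<close>
    moreover have "((\<lambda>t. (H t + k) * ?b t + q t * \<beta> t) has_integral 0) {-R..R}"
      using R \<beta> by (intro integral_by_parts_compact)
        (auto intro!: continuous_intros derivative_eq_intros H contH cont\<beta>)
    ultimately have "((\<lambda>t. (f t - k) * ?b t) has_integral 0) {-R..R}"
      by (rule has_integral_eq_rhs[OF has_integral_eq[OF _ has_integral_diff], rotated])
         (auto simp: f_def algebra_simps)
    then have "integral {-R..R} (\<lambda>t. (f t - k) * ?b t) = 0" by (rule integral_unique)
    moreover have "(f x - k) * ?b x \<ge> 0" for x
    proof -
      \<comment> \<open>A point within \<open>e\<close> of both centres is impossible:
        \<open>f\<close> would be above and below \<open>k\<close> there.\<close>
      consider "\<bar>x - t1\<bar> < e" "\<bar>x - t2\<bar> \<ge> e" | "\<bar>x - t1\<bar> \<ge> e" "\<bar>x - t2\<bar> < e" | "\<bar>x - t1\<bar> \<ge> e" "\<bar>x - t2\<bar> \<ge> e"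
        using e1(2)[of x] e2(2)[of x] e by fastforce
      then show ?thesis
        using e1(2)[of x] e2(2)[of x] e bump_zero[of e x t1] bump_zero[of e x t2]
          bump_nonneg[of e t1 x] bump_nonneg[of e t2 x]
        by cases (auto intro: mult_nonneg_nonneg simp: mult_nonpos_nonneg)
    qed
    moreover have "t1 \<in> {-R..R}" using R e by auto
    moreover have "continuous_on {-R..R} (\<lambda>t. (f t - k) * ?b t)"
      by (intro continuous_intros contf bump_continuous)
    ultimately have "(f t1 - k) * ?b t1 = 0"
      using integral_eq_0_iff[of "-R" R "\<lambda>t. (f t - k) * ?b t"] R e by simp
    moreover have "\<bar>t1 - t2\<bar> \<ge> e" using e1(2)[of t1] e2(2)[of t1] e by fastforce
    ultimately show False using bump_pos[of t1 t1 e] bump_zero[of e t1 t2] e k by auto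
  qed
  define k where "k = p 0 - H 0"
  have "p t = H t + k" for t using le[of t 0] le[of 0 t] by (simp add: k_def)
  then have "p = (\<lambda>t. H t + k)" by auto
  then show ?thesis by (auto intro!: derivative_eq_intros H)
qed

section \<open>Partial derivatives and Green's formula on a strip\<close>

lemma has_derivative_partials:
  fixes u :: "real \<times> real \<Rightarrow> real"
  assumes "(u has_derivative u') (at (r, t))"
  shows "((\<lambda>r. u (r, t)) has_real_derivative u' (1, 0)) (at r)"
    and "((\<lambda>t. u (r, t)) has_real_derivative u' (0, 1)) (at t)"
proof -
  have lin: "linear u'" using assms by (rule has_derivative_linear)
  have *: "u' (h, 0) = u' (1, 0) * h" "u' (0, h) = u' (0, 1) * h" for h
    using linear_scale[OF lin, of h "(1, 0)"] linear_scale[OF lin, of h "(0, 1)"]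
    by (simp_all add: mult.commute)
  have 1: "(\<lambda>h. u' (h, 0)) = (*) (u' (1, 0))" by (rule ext) (rule *(1))
  have 2: "(\<lambda>h. u' (0, h)) = (*) (u' (0, 1))" by (rule ext) (rule *(2))
  have "((\<lambda>r. (r, t)) has_derivative (\<lambda>h. (h, 0))) (at r)"
    by (intro derivative_intros)
  from has_derivative_eq_rhs[OF has_derivative_compose[OF this assms] 1]
  show "((\<lambda>r. u (r, t)) has_real_derivative u' (1, 0)) (at r)"
    by (simp only: has_field_derivative_def)
  have "((\<lambda>t. (r, t)) has_derivative (\<lambda>h. (0, h))) (at t)"
    by (intro derivative_intros)
  from has_derivative_eq_rhs[OF has_derivative_compose[OF this assms] 2]
  show "((\<lambda>t. u (r, t)) has_real_derivative u' (0, 1)) (at t)"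
    by (simp only: has_field_derivative_def)
qed

lemma pd_r_eqI: "((\<lambda>r. u (r, t)) has_real_derivative D) (at r) \<Longrightarrow> pd_r u (r, t) = D"
  by (simp add: pd_r_def DERIV_imp_deriv)

lemma pd_t_eqI: "((\<lambda>t. u (r, t)) has_real_derivative D) (at t) \<Longrightarrow> pd_t u (r, t) = D"
  by (simp add: pd_t_def DERIV_imp_deriv)

lemma differentiable_rI: "((\<lambda>r. u (r, t)) has_real_derivative D) (at r) \<Longrightarrow> differentiable_r u (r, t)"
  by (auto simp: differentiable_r_def real_differentiable_def)

lemma differentiable_tI: "((\<lambda>t. u (r, t)) has_real_derivative D) (at t) \<Longrightarrow> differentiable_t u (r, t)"
  by (auto simp: differentiable_t_def real_differentiable_def)

lemma differentiable_rD:
  "differentiable_r u (r, t) \<Longrightarrow> ((\<lambda>r. u (r, t)) has_real_derivative pd_r u (r, t)) (at r)"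
  by (simp add: differentiable_r_def pd_r_def DERIV_deriv_iff_real_differentiable)

lemma differentiable_tD:
  "differentiable_t u (r, t) \<Longrightarrow> ((\<lambda>t. u (r, t)) has_real_derivative pd_t u (r, t)) (at t)"
  by (simp add: differentiable_t_def pd_t_def DERIV_deriv_iff_real_differentiable)

lemma Ck_on_1_partials:
  assumes "Ck_on 1 S u"
  shows "\<forall>z\<in>S. differentiable_r u z" "\<forall>z\<in>S. differentiable_t u z"
    "continuous_on S (pd_r u)" "continuous_on S (pd_t u)" "continuous_on S u"
proof -
  obtain u' where u': "\<And>z. z \<in> S \<Longrightarrow> (u has_derivative u' z) (at z)"
    "\<And>v. continuous_on S (\<lambda>z. u' z v)"
    using assms by auto
  note d = has_derivative_partials[OF u'(1)]
  show "\<forall>z\<in>S. differentiable_r u z" "\<forall>z\<in>S. differentiable_t u z"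
    using differentiable_rI[OF d(1)] differentiable_tI[OF d(2)] by auto
  have "pd_r u z = u' z (1, 0)" "pd_t u z = u' z (0, 1)" if "z \<in> S" for z
    using that pd_r_eqI[OF d(1)] pd_t_eqI[OF d(2)] by (cases z; simp)+
  then show "continuous_on S (pd_r u)" "continuous_on S (pd_t u)"
    using u'(2)[of "(1, 0)"] u'(2)[of "(0, 1)"] by (auto cong: continuous_on_cong)
  show "continuous_on S u"
    using Ck_on_SucD[of 0 S u] assms by simp
qed

lemma zero_outside_closed_partials:
  assumes "closed C" "\<And>z. z \<notin> C \<Longrightarrow> \<phi> z = 0" "z \<notin> C"
  shows "pd_r \<phi> z = 0" "pd_t \<phi> z = 0"
proof -
  obtain r t where z: "z = (r, t)" by fastforce
  have "((\<lambda>_. 0) has_derivative (\<lambda>_. 0)) (at z)" by simp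
  then have "(\<phi> has_derivative (\<lambda>_. 0)) (at z)"
    by (rule has_derivative_transform_within_open[where s="- C"]) (use assms in auto)
  from has_derivative_partials[OF this[unfolded z]]
  show "pd_r \<phi> z = 0" "pd_t \<phi> z = 0" unfolding z by (auto intro: pd_r_eqI pd_t_eqI)
qed

section \<open>Test functions on the plane: regularity, boxes containing the support,
  products\<close>

lemma test_function_C1:
  assumes "test_function \<phi>"
  shows "((\<lambda>r. \<phi> (r, t)) has_real_derivative pd_r \<phi> (r, t)) (at r)"
    "((\<lambda>t. \<phi> (r, t)) has_real_derivative pd_t \<phi> (r, t)) (at t)"
    "continuous_on S (pd_r \<phi>)" "continuous_on S (pd_t \<phi>)" "continuous_on S \<phi>"
proof -
  have "Ck_on 1 UNIV \<phi>" using assms by (auto simp: test_function_def simp del: Ck_on.simps)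
  note C = Ck_on_1_partials[OF this]
  show "((\<lambda>r. \<phi> (r, t)) has_real_derivative pd_r \<phi> (r, t)) (at r)"
    "((\<lambda>t. \<phi> (r, t)) has_real_derivative pd_t \<phi> (r, t)) (at t)"
    by (rule differentiable_rD[OF C(1)[rule_format, OF UNIV_I]]
        differentiable_tD[OF C(2)[rule_format, OF UNIV_I]])+
  show "continuous_on S (pd_r \<phi>)" "continuous_on S (pd_t \<phi>)" "continuous_on S \<phi>"
    by (rule continuous_on_subset[OF C(3)] continuous_on_subset[OF C(4)]
        continuous_on_subset[OF C(5)], simp)+
qed

text \<open>The parameter \<open>M\<close> allows a box wide enough to be crossed by both lines.
  \<open>R\<close> exceeds the bound on the support by 1, so \<open>\<phi>\<close> vanishes on the
  edges of the box too and they add no boundary terms.\<close>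

lemma test_function_box:
  assumes "test_function \<phi>"
  obtains R where "R > M" "\<And>z. z \<notin> cbox (- R, - R) (R, R) \<Longrightarrow> \<phi> z = 0"
    "\<And>r t. \<bar>t\<bar> \<ge> R \<or> \<bar>r\<bar> \<ge> R \<Longrightarrow> \<phi> (r, t) = 0"
proof -
  have "bounded (closure {z. \<phi> z \<noteq> 0})"
    using assms unfolding test_function_def by (intro compact_imp_bounded) simp
  then obtain B where B: "\<And>z. \<phi> z \<noteq> 0 \<Longrightarrow> norm z \<le> B"
    unfolding bounded_iff by (metis (mono_tags) closure_subset mem_Collect_eq subsetD)
  define R where "R = max M B + 1"
  have le: "\<bar>r\<bar> < R \<and> \<bar>t\<bar> < R" if "\<phi> (r, t) \<noteq> 0" for r t
    using B[OF that] norm_fst_le[of r t] norm_snd_le[of t r] by (auto simp: R_def)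
  show ?thesis
  proof
    show "R > M" by (auto simp: R_def)
    show "\<phi> z = 0" if "z \<notin> cbox (- R, - R) (R, R)" for z
      using that le[of "fst z" "snd z"] by (cases z) (force simp: cbox_Pair_eq)
    show "\<phi> (r, t) = 0" if "\<bar>t\<bar> \<ge> R \<or> \<bar>r\<bar> \<ge> R" for r t
      using that le[of r t] by force
  qed
qed

lemma test_function_product:
  assumes "\<And>k. Ck_on k UNIV \<alpha>" "\<And>k. Ck_on k UNIV \<beta>"
    and "\<And>r. r \<notin> {c..d} \<Longrightarrow> \<alpha> r = 0" "\<And>t. \<bar>t\<bar> \<ge> R \<Longrightarrow> \<beta> t = 0"
  shows "test_function (\<lambda>z. \<alpha> (fst z) * \<beta> (snd z))"
proof -
  have "Ck_on k UNIV (\<lambda>z::real \<times> real. \<alpha> (fst z + 0) * \<beta> (snd z + 0))" for k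
    by (intro Ck_on_mult Ck_on_compose_affine bounded_linear_fst bounded_linear_snd assms(1,2))
  moreover have "{z. \<alpha> (fst z) * \<beta> (snd z) \<noteq> 0} \<subseteq> cbox (c, - R) (d, R)"
    using assms(3,4) by (force simp: cbox_Pair_eq)
  then have "bounded {z. \<alpha> (fst z) * \<beta> (snd z) \<noteq> 0}"
    using bounded_cbox bounded_subset by blast
  ultimately show ?thesis by (simp add: test_function_def)
qed

text \<open>The derivatives need not be bounded near \<open>r = c\<close> and \<open>r = d\<close>, so the divergence theorem is
  obtained by differentiating the slice integral of \<open>Q \<phi>\<close>, whose derivative does not involve them.\<close>

lemma green_strip:
  fixes P Q g P' Q' g' \<phi> :: "real \<times> real \<Rightarrow> real"
  assumes cd: "c \<le> d" and R: "R > 0" and \<phi>: "test_function \<phi>"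
    and \<phi>0: "\<And>r. \<phi> (r, R) = 0" "\<And>r. \<phi> (r, - R) = 0"
    and cont: "continuous_on ({c..d} \<times> UNIV) P'" "continuous_on ({c..d} \<times> UNIV) Q'"
      "continuous_on ({c..d} \<times> UNIV) g'"
    and eq: "\<And>r t. r \<in> {c<..<d} \<Longrightarrow> P (r, t) = P' (r, t) \<and> Q (r, t) = Q' (r, t) \<and> g (r, t) = g' (r, t)"
    and diff: "\<And>r t. r \<in> {c<..<d} \<Longrightarrow> differentiable_t P (r, t) \<and> differentiable_r Q (r, t)"
    and Qr: "continuous_on ({c<..<d} \<times> UNIV) (pd_r Q)"
    and pde: "\<And>r t. r \<in> {c<..<d} \<Longrightarrow> pd_t P (r, t) + pd_r Q (r, t) + g (r, t) = 0"
  shows "integral (cbox (c, - R) (d, R)) (\<lambda>z. P' z * pd_t \<phi> z + Q' z * pd_r \<phi> z - g' z * \<phi> z)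
    = integral {- R..R} (\<lambda>t. Q' (d, t) * \<phi> (d, t)) - integral {- R..R} (\<lambda>t. Q' (c, t) * \<phi> (c, t))"
proof -
  note T = test_function_C1[OF \<phi>]
  define h where "h z = P' z * pd_t \<phi> z + Q' z * pd_r \<phi> z - g' z * \<phi> z" for z
  have slice: "continuous_on S (\<lambda>t. f (r, t))" if "continuous_on ({c..d} \<times> UNIV) f" "r \<in> {c..d}"
    for f :: "real \<times> real \<Rightarrow> real" and r S
    by (rule continuous_on_compose2[OF that(1)]) (use that in \<open>auto intro!: continuous_intros\<close>)
  have contT: "continuous_on S (\<lambda>t. \<phi> (r, t))" "continuous_on S (\<lambda>t. pd_t \<phi> (r, t))"
    "continuous_on S (\<lambda>t. pd_r \<phi> (r, t))" for S and r :: real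
    by (auto intro!: continuous_on_compose2[OF T(3)[of UNIV]] continuous_on_compose2[OF T(4)[of UNIV]]
        continuous_on_compose2[OF T(5)[of UNIV]] continuous_intros)
  have conth: "continuous_on ({c..d} \<times> UNIV) h"
    unfolding h_def by (intro continuous_intros cont T)
  define F where "F r = integral {- R..R} (\<lambda>t. Q' (r, t) * \<phi> (r, t))" for r
  have contF: "continuous_on {c..d} F"
    unfolding F_def box_real(2)[symmetric]
    by (rule integral_continuous_on_param)
       (auto simp: case_prod_unfold intro!: continuous_intros T continuous_on_subset[OF cont(2)])
  \<comment> \<open>The Leibniz rule yields the slice integral of
    \<open>pd_r Q * \<phi> + Q' * pd_r \<phi>\<close>. The equation trades \<open>pd_r Q\<close> for
    \<open>- pd_t P - g\<close>, and integration by parts in \<open>t\<close> moves the derivative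
    onto \<open>\<phi>\<close>; what is left is \<open>h\<close>, which is continuous up to the
    edges.\<close>
  have derF: "(F has_vector_derivative integral {- R..R} (\<lambda>t. h (r, t))) (at r)" if r: "r \<in> {c<..<d}" for r
  proof -
    let ?U = "{c<..<d}"
    have r': "r \<in> {c..d}" using r by auto
    have derQ': "((\<lambda>r. Q' (r, t)) has_real_derivative pd_r Q (r, t)) (at r)" if "r \<in> ?U" for r t
      using differentiable_rD[of Q r t, OF conjunct2[OF diff[OF that]]]
      by (rule has_field_derivative_transform_within_open[where S="?U"]) (use eq that in auto)
    have "((\<lambda>r. integral (cbox (- R) R) (\<lambda>t. Q' (r, t) * \<phi> (r, t))) has_real_derivative
        integral (cbox (- R) R) (\<lambda>t. pd_r Q (r, t) * \<phi> (r, t) + Q' (r, t) * pd_r \<phi> (r, t))) (at r within ?U)"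
    proof (rule leibniz_rule_field_derivative)
      fix x t assume "x \<in> ?U"
      then have "((\<lambda>x. Q' (x, t) * \<phi> (x, t)) has_real_derivative
          pd_r Q (x, t) * \<phi> (x, t) + Q' (x, t) * pd_r \<phi> (x, t)) (at x)"
        by (auto intro!: derivative_eq_intros derQ' T)
      then show "((\<lambda>x. Q' (x, t) * \<phi> (x, t)) has_real_derivative
          pd_r Q (x, t) * \<phi> (x, t) + Q' (x, t) * pd_r \<phi> (x, t)) (at x within ?U)"
        by (rule has_field_derivative_at_within)
    next
      fix x assume "x \<in> ?U"
      then show "(\<lambda>t. Q' (x, t) * \<phi> (x, t)) integrable_on cbox (- R) R"
        by (intro integrable_continuous continuous_intros slice cont contT) auto
    next
      show "continuous_on (?U \<times> cbox (- R) R)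
          (\<lambda>(x, t). pd_r Q (x, t) * \<phi> (x, t) + Q' (x, t) * pd_r \<phi> (x, t))"
        by (auto simp: case_prod_unfold intro!: continuous_intros T
            intro: continuous_on_subset[OF Qr] continuous_on_subset[OF cont(2)])
    qed (use r in auto)
    then have dF: "(F has_real_derivative
        integral {- R..R} (\<lambda>t. pd_r Q (r, t) * \<phi> (r, t) + Q' (r, t) * pd_r \<phi> (r, t))) (at r)"
      using r by (simp add: F_def[abs_def] at_within_open[of r ?U])
    have contQr: "continuous_on S (\<lambda>t. pd_r Q (r, t))" for S
      by (rule continuous_on_compose2[OF Qr]) (use r in \<open>auto intro!: continuous_intros\<close>)
    have P't: "((\<lambda>t. P' (r, t)) has_real_derivative - pd_r Q (r, t) - g' (r, t)) (at t)" for t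
    proof -
      have "(\<lambda>t. P (r, t)) = (\<lambda>t. P' (r, t))" using eq r by auto
      moreover have "pd_t P (r, t) = - pd_r Q (r, t) - g' (r, t)" using pde[OF r, of t] eq[OF r, of t] by simp
      ultimately show ?thesis using differentiable_tD[of P r t] diff[OF r] by simp
    qed
    have 1: "((\<lambda>t. P' (r, t) * pd_t \<phi> (r, t) + (- pd_r Q (r, t) - g' (r, t)) * \<phi> (r, t))
        has_integral 0) {- R..R}"
      by (rule integral_by_parts_compact) (use R r' in \<open>auto intro!: slice cont contT P't T \<phi>0\<close>)
    have "(\<lambda>t. pd_r Q (r, t) * \<phi> (r, t) + Q' (r, t) * pd_r \<phi> (r, t)) integrable_on {- R..R}"
      by (intro integrable_continuous_real continuous_intros slice cont contT contQr r')
    from has_integral_add[OF 1 integrable_integral[OF this]]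
    have "((\<lambda>t. h (r, t)) has_integral
        integral {- R..R} (\<lambda>t. pd_r Q (r, t) * \<phi> (r, t) + Q' (r, t) * pd_r \<phi> (r, t))) {- R..R}"
      by (rule has_integral_eq_rhs[OF has_integral_eq[rotated]]) (auto simp: h_def algebra_simps)
    then show ?thesis
      using dF by (simp add: integral_unique has_real_derivative_iff_has_vector_derivative)
  qed
  \<comment> \<open>Continuity of \<open>F\<close> on the closed interval and its derivative in the
    open one are enough, so no estimate of \<open>pd_r Q\<close> at the edges enters.\<close>
  have "((\<lambda>r. integral {- R..R} (\<lambda>t. h (r, t))) has_integral F d - F c) {c..d}"
    by (rule fundamental_theorem_of_calculus_interior[OF cd contF derF])
  moreover have "integral (cbox (c, - R) (d, R)) h
      = integral (cbox c d) (\<lambda>r. integral (cbox (- R) R) (\<lambda>t. h (r, t)))"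
    by (rule integral_prod_continuous[OF continuous_on_subset[OF conth]]) (auto simp: cbox_Pair_eq)
  ultimately show ?thesis
    by (simp add: h_def[abs_def] F_def integral_unique)
qed

text \<open>Since \<open>pd_r Q\<close> is known to be continuous inside, the equation can be read
  for each fixed \<open>r0\<close> as an ordinary one, \<open>pd_t P = q\<close>, with a known
  continuous right-hand side.\<close>

lemma local_classical:
  fixes P Q g P' Q' g' :: "real \<times> real \<Rightarrow> real"
  assumes cont: "continuous_on UNIV P'" "continuous_on UNIV Q'" "continuous_on UNIV g'"
    and eq: "\<And>r t. r \<in> {c<..<d} \<Longrightarrow> P (r, t) = P' (r, t) \<and> Q (r, t) = Q' (r, t) \<and> g (r, t) = g' (r, t)"
    and Qdiff: "\<And>r t. r \<in> {c<..<d} \<Longrightarrow> differentiable_r Q (r, t)"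
    and Qr: "continuous_on ({c<..<d} \<times> UNIV) (pd_r Q)"
    and weak: "\<And>\<phi>. test_function \<phi> \<Longrightarrow> (\<And>r t. r \<notin> {c<..<d} \<Longrightarrow> \<phi> (r, t) = 0) \<Longrightarrow>
      integral UNIV (\<lambda>z. P z * pd_t \<phi> z + Q z * pd_r \<phi> z - g z * \<phi> z) = 0"
    and r0: "r0 \<in> {c<..<d}"
  shows "differentiable_t P (r0, t0) \<and> pd_t P (r0, t0) + pd_r Q (r0, t0) + g (r0, t0) = 0"
proof -
  \<comment> \<open>On the smaller closed interval \<open>pd_r Q\<close> is continuous up to the
    ends, which the integrals over boxes below require.\<close>
  define c' d' where "c' = (c + r0) / 2" and "d' = (d + r0) / 2"
  have cd: "c < c'" "c' < r0" "r0 < d'" "d' < d" using r0 by (auto simp: c'_def d'_def)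
  have sub: "r \<in> {c<..<d}" if "r \<in> {c'..d'}" for r using cd that by auto
  define q where "q z = - g' z - pd_r Q z" for z
  have contq: "continuous_on ({c'..d'} \<times> UNIV) q"
    unfolding q_def using sub
    by (intro continuous_intros continuous_on_subset[OF Qr] continuous_on_subset[OF cont(3)]) auto
  have slice: "continuous_on S (\<lambda>t. f (r, t))" if "continuous_on ({c'..d'} \<times> UNIV) f" "r \<in> {c'..d'}"
    for f :: "real \<times> real \<Rightarrow> real" and r S
    by (rule continuous_on_compose2[OF that(1)]) (use that in \<open>auto intro!: continuous_intros\<close>)
  have r0': "r0 \<in> {c'..d'}" using cd by auto
  have "((\<lambda>t. P' (r0, t)) has_real_derivative q (r0, t0)) (at t0)"
  proof (rule du_Bois_Reymond)
    show "continuous_on UNIV (\<lambda>t. P' (r0, t))" "continuous_on UNIV (\<lambda>t. q (r0, t))"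
      by (intro slice contq r0' continuous_on_subset[OF cont(1)] subset_UNIV)+
    fix \<beta> \<beta>' R
    assume R: "R > 0" and \<beta>: "\<And>k. Ck_on k UNIV \<beta>" "\<And>t. (\<beta> has_real_derivative \<beta>' t) (at t)"
      "\<And>t. \<bar>t\<bar> \<ge> R \<Longrightarrow> \<beta> t = 0"
    have cont\<beta>: "continuous_on S \<beta>" for S
      by (rule DERIV_continuous_on[OF has_field_derivative_at_within[OF \<beta>(2)]])
    \<comment> \<open>Continuity of \<open>\<beta>'\<close> is hidden in the smoothness of
      \<open>\<beta>\<close>; uniqueness of the derivative brings it out.\<close>
    obtain \<beta>'' where \<beta>'': "\<And>t. (\<beta> has_derivative \<beta>'' t) (at t)" "\<And>v. continuous_on UNIV (\<lambda>t. \<beta>'' t v)"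
      using \<beta>(1)[of 1] by auto
    have "\<beta>'' t = (*) (\<beta>' t)" for t
      by (rule has_derivative_unique[OF \<beta>''(1) \<beta>(2)[unfolded has_field_derivative_def]])
    then have "continuous_on UNIV (\<lambda>t. \<beta>' t * 1)" using \<beta>''(2)[of 1] by simp
    then have cont\<beta>': "continuous_on S \<beta>'" for S by (auto intro: continuous_on_subset)
    \<comment> \<open>The pairing of the du Bois-Reymond lemma on the slice \<open>r\<close>, as a
      function of \<open>r\<close>; it has to vanish at \<open>r0\<close>.\<close>
    define K where "K r = integral {- R..R} (\<lambda>t. P' (r, t) * \<beta>' t + q (r, t) * \<beta> t)" for r
    have "K r0 = 0"
    proof (rule fundamental_lemma_real[where w=K and c=c' and d=d'])
      have cont2: "continuous_on S (\<lambda>z. f (snd z))" if "\<And>S. continuous_on S f"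
        for f :: "real \<Rightarrow> real" and S :: "(real \<times> real) set"
        by (rule continuous_on_compose2[OF that[of UNIV]]) (auto intro!: continuous_intros)
      show "continuous_on {c'..d'} K"
        unfolding K_def box_real(2)[symmetric]
        by (rule integral_continuous_on_param)
           (simp only: case_prod_unfold prod.collapse, intro continuous_intros cont2 cont\<beta> cont\<beta>'
             continuous_on_subset[OF cont(1)] continuous_on_subset[OF contq], auto)
      fix e :: real assume e: "e > 0" "c' < r0 - e" "r0 + e < d'"
      define \<phi> where "\<phi> z = bump e r0 (fst z) * \<beta> (snd z)" for z
      have \<phi>0: "\<phi> z = 0" if "z \<notin> cbox (c', - R) (d', R)" for z
        using that e bump_zero[of e "fst z" r0] \<beta>(3)[of "snd z"]
        by (cases z) (force simp: \<phi>_def cbox_Pair_eq)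
      have test: "test_function \<phi>"
        unfolding \<phi>_def
        by (rule test_function_product[where c=c' and d=d'])
           (use \<beta> e bump_zero[of e _ r0] in \<open>auto intro!: bump_Ck\<close>)
      note T = test_function_C1[OF test]
      have pdt: "pd_t \<phi> (r, t) = bump e r0 r * \<beta>' t" for r t
        unfolding \<phi>_def by (rule pd_t_eqI) (auto intro!: derivative_eq_intros \<beta>)
      let ?I = "integral (cbox (c', - R) (d', R))"
      let ?f1 = "\<lambda>z. P' z * pd_t \<phi> z + Q' z * pd_r \<phi> z - g' z * \<phi> z"
      let ?f2 = "\<lambda>z. 0 * pd_t \<phi> z + Q' z * pd_r \<phi> z - - pd_r Q z * \<phi> z"
      have contQr: "continuous_on ({c'..d'} \<times> UNIV) (pd_r Q)"
        by (rule continuous_on_subset[OF Qr]) (use sub in auto)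
      have int: "?f1 integrable_on cbox (c', - R) (d', R)" "?f2 integrable_on cbox (c', - R) (d', R)"
        by (intro integrable_continuous continuous_intros T; (rule continuous_on_subset[OF cont(1)]
          continuous_on_subset[OF cont(2)] continuous_on_subset[OF cont(3)] continuous_on_subset[OF contQr]);
          auto simp: cbox_Pair_eq)+
      have "?I ?f1 = ?I (\<lambda>z. P z * pd_t \<phi> z + Q z * pd_r \<phi> z - g z * \<phi> z)"
      proof (rule integral_cong)
        fix z assume "z \<in> cbox (c', - R) (d', R)"
        then have "fst z \<in> {c<..<d}" by (intro sub) (auto simp: cbox_Pair_eq)
        then show "?f1 z = P z * pd_t \<phi> z + Q z * pd_r \<phi> z - g z * \<phi> z"
          using eq[of "fst z" "snd z"] by simp
      qed
      also have "\<dots> = integral UNIV (\<lambda>z. if z \<in> cbox (c', - R) (d', R) then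
          P z * pd_t \<phi> z + Q z * pd_r \<phi> z - g z * \<phi> z else 0)"
        by (rule integral_restrict_UNIV[symmetric])
      also have "\<dots> = integral UNIV (\<lambda>z. P z * pd_t \<phi> z + Q z * pd_r \<phi> z - g z * \<phi> z)"
        using \<phi>0 zero_outside_closed_partials[OF closed_cbox \<phi>0]
        by (intro integral_cong) auto
      also have "\<dots> = 0"
        by (rule weak[OF test]) (use \<phi>0 cd in \<open>auto simp: cbox_Pair_eq\<close>)
      finally have 1: "?I ?f1 = 0" .
      \<comment> \<open>Integration by parts in \<open>r\<close>, obtained as Green's formula for
        the trivial equation \<open>0 + pd_r Q + (- pd_r Q) = 0\<close>. Subtracting
        \<open>?f2\<close> from \<open>?f1\<close> removes \<open>pd_r \<phi>\<close> and leaves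
        \<open>P' * pd_t \<phi> + q * \<phi>\<close>.\<close>
      have "?I ?f2 = integral {- R..R} (\<lambda>t. Q' (d', t) * \<phi> (d', t)) - integral {- R..R} (\<lambda>t. Q' (c', t) * \<phi> (c', t))"
      proof (rule green_strip[where P="\<lambda>_. 0" and Q=Q and g="\<lambda>z. - pd_r Q z"])
        show "\<phi> (r, R) = 0" "\<phi> (r, - R) = 0" for r using \<beta>(3) R by (auto simp: \<phi>_def)
        show "continuous_on ({c'<..<d'} \<times> UNIV) (pd_r Q)"
          by (rule continuous_on_subset[OF Qr]) (use sub in auto)
        show "differentiable_t (\<lambda>_. 0) (r, t) \<and> differentiable_r Q (r, t)" if "r \<in> {c'<..<d'}" for r t
          using that Qdiff sub[of r] by (auto simp: differentiable_t_def)
        show "continuous_on ({c'..d'} \<times> UNIV) (\<lambda>z. - pd_r Q z)" by (intro continuous_intros contQr)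
        show "continuous_on ({c'..d'} \<times> UNIV) Q'" by (rule continuous_on_subset[OF cont(2)]) auto
      qed (use cd R test eq sub in \<open>auto simp: pd_t_def\<close>)
      also have "\<dots> = 0"
        using e by (simp add: \<phi>_def bump_zero)
      finally have 2: "?I ?f2 = 0" .
      let ?f3 = "\<lambda>z. P' z * pd_t \<phi> z + q z * \<phi> z"
      have "?I ?f3 = ?I (\<lambda>z. ?f1 z - ?f2 z)"
        by (intro integral_cong) (auto simp: q_def algebra_simps)
      also have "\<dots> = 0" using integral_diff[OF int] 1 2 by simp
      finally have "?I ?f3 = 0" .
      moreover have "?I ?f3 = integral (cbox c' d') (\<lambda>r. integral (cbox (- R) R) (\<lambda>t. ?f3 (r, t)))"
        by (rule integral_prod_continuous, intro continuous_intros T;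
            (rule continuous_on_subset[OF cont(1)] continuous_on_subset[OF contq]); auto simp: cbox_Pair_eq)
      moreover have "integral (cbox (- R) R) (\<lambda>t. ?f3 (r, t)) = K r * bump e r0 r" for r
        by (simp add: K_def pdt \<phi>_def algebra_simps flip: integral_mult_right)
      ultimately show "integral {c'..d'} (\<lambda>r. K r * bump e r0 r) = 0" by simp
    qed (use cd in auto)
    then show "integral {- R..R} (\<lambda>t. P' (r0, t) * \<beta>' t + q (r0, t) * \<beta> t) = 0" by (simp add: K_def)
  qed
  moreover have "(\<lambda>t. P (r0, t)) = (\<lambda>t. P' (r0, t))" using eq r0 by auto
  ultimately have "((\<lambda>t. P (r0, t)) has_real_derivative q (r0, t0)) (at t0)" by simp
  from differentiable_tI[OF this] pd_t_eqI[OF this] show ?thesis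
    using eq[OF r0, of t0] by (simp add: q_def)
qed

section \<open>Functions continuous up to the boundary of each strip\<close>

text \<open>The representatives are continuous on the whole plane and not merely on closed strips:
  sums and products then preserve the form with no side conditions on domains, and one-sided limits
  on the lines are plain values. Nothing is said about \<open>u\<close> on the lines.\<close>

definition strips where
  "strips a b u uL uM uR \<longleftrightarrow>
     continuous_on UNIV uL \<and> continuous_on UNIV uM \<and> continuous_on UNIV uR
   \<and> (\<forall>r t. (r < a \<longrightarrow> u (r, t) = uL (r, t)) \<and> (a < r \<and> r < b \<longrightarrow> u (r, t) = uM (r, t))
        \<and> (b < r \<longrightarrow> u (r, t) = uR (r, t)))"
  for a b :: real and u uL uM uR :: "real \<times> real \<Rightarrow> real"

lemma strips_continuous: "continuous_on UNIV u \<Longrightarrow> strips a b u u u u"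
  by (simp add: strips_def)

lemma strips_add:
  "strips a b u uL uM uR \<Longrightarrow> strips a b v vL vM vR \<Longrightarrow>
    strips a b (\<lambda>z. u z + v z) (\<lambda>z. uL z + vL z) (\<lambda>z. uM z + vM z) (\<lambda>z. uR z + vR z)"
  by (auto simp: strips_def intro!: continuous_intros)

lemma strips_mult:
  "strips a b u uL uM uR \<Longrightarrow> strips a b v vL vM vR \<Longrightarrow>
    strips a b (\<lambda>z. u z * v z) (\<lambda>z. uL z * vL z) (\<lambda>z. uM z * vM z) (\<lambda>z. uR z * vR z)"
  by (auto simp: strips_def intro!: continuous_intros)

lemma strips_diff:
  "strips a b u uL uM uR \<Longrightarrow> strips a b v vL vM vR \<Longrightarrow>
    strips a b (\<lambda>z. u z - v z) (\<lambda>z. uL z - vL z) (\<lambda>z. uM z - vM z) (\<lambda>z. uR z - vR z)"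
  by (auto simp: strips_def intro!: continuous_intros)

text \<open>Extension by limits is continuous on the closure, because each new value is itself a
  limit of values of \<open>f\<close> taken in the same small ball. Tietze's theorem then extends it
  to the whole space.\<close>

lemma continuous_extension_from_limits:
  fixes f :: "'a::euclidean_space \<Rightarrow> real"
  assumes cont: "continuous_on S f" and S: "open S"
    and lim: "\<And>x. x \<in> closure S \<Longrightarrow> x \<notin> S \<Longrightarrow> \<exists>l. (f \<longlongrightarrow> l) (at x within S)"
  obtains g where "continuous_on UNIV g" "\<And>x. x \<in> S \<Longrightarrow> g x = f x"
proof -
  have nt: "at x within S \<noteq> bot" if "x \<in> closure S" for x
    using that S by (metis closure_def UnE islimpt_def mem_Collect_eq open_imp_islimpt trivial_limit_within)
  have lim': "\<exists>l. (f \<longlongrightarrow> l) (at x within S)" if "x \<in> closure S" for x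
    using lim[OF that] cont unfolding continuous_on_def by blast
  define h where "h x = Lim (at x within S) f" for x
  have h: "(f \<longlongrightarrow> h x) (at x within S)" if "x \<in> closure S" for x
    using lim'[OF that] nt[OF that] by (auto simp: h_def tendsto_Lim)
  have hf: "h x = f x" if "x \<in> S" for x
    using that cont nt[of x] closure_subset[of S]
    by (auto simp: h_def continuous_on_def intro: tendsto_Lim)
  have "continuous_on (closure S) h"
    unfolding continuous_on_iff
  proof (intro ballI allI impI)
    fix x and e :: real assume x: "x \<in> closure S" and e: "e > 0"
    \<comment> \<open>Passing to the limit at a neighbouring \<open>y\<close> only keeps a
      non-strict bound; \<open>e / 2\<close> leaves room for this.\<close>
    have "\<forall>\<^sub>F y in at x within S. dist (f y) (h x) < e / 2"
      using h[OF x] e by (intro tendstoD) auto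
    then obtain \<delta> where \<delta>: "\<delta> > 0"
      "\<And>y. y \<in> S \<Longrightarrow> y \<noteq> x \<Longrightarrow> dist y x < \<delta> \<Longrightarrow> dist (f y) (h x) < e / 2"
      unfolding eventually_at by blast
    have \<delta>': "dist (f y) (h x) \<le> e / 2" if "y \<in> S" "dist y x < \<delta>" for y
      using \<delta>(2)[of y] that hf e by (cases "y = x") auto
    have "dist (h y) (h x) < e" if y: "y \<in> closure S" "dist y x < \<delta>" for y
    proof -
      have "\<forall>\<^sub>F z in at y within S. z \<in> S \<and> z \<in> ball x \<delta>"
        unfolding eventually_at_topological
        by (intro exI[of _ "ball x \<delta>"]) (use y in \<open>auto simp: dist_commute\<close>)
      then have "\<forall>\<^sub>F z in at y within S. dist (f z) (h x) \<le> e / 2"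
        by (rule eventually_mono) (use \<delta>' in \<open>auto simp: dist_commute\<close>)
      then have "dist (h y) (h x) \<le> e / 2"
        by (rule tendsto_upperbound[OF tendsto_dist[OF h[OF y(1)] tendsto_const]]) (use nt y in auto)
      then show ?thesis using e by simp
    qed
    then show "\<exists>d>0. \<forall>x'\<in>closure S. dist x' x < d \<longrightarrow> dist (h x') (h x) < e"
      using \<delta> by blast
  qed
  then obtain g where g: "continuous_on UNIV g" "\<And>x. x \<in> closure S \<Longrightarrow> g x = h x"
    by (rule Tietze_unbounded) (auto simp: closed_closedin[symmetric])
  show ?thesis
    by (rule that[OF g(1)]) (use g(2) hf closure_subset[of S] in auto)
qed

lemma closure_times_UNIV: "closure (I \<times> (UNIV :: real set)) = closure I \<times> UNIV" for I :: "real set"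
  by (simp add: closure_Times)

lemma strips_of_limits:
  assumes ab: "a < b" and cont: "continuous_on (Omega a b) u"
    and lim: "\<forall>r0\<in>{a, b}. \<forall>t0. (\<exists>l. (u \<longlongrightarrow> l) (left_of r0 t0)) \<and> (\<exists>l. (u \<longlongrightarrow> l) (right_of r0 t0))"
  shows "\<exists>uL uM uR. strips a b u uL uM uR"
proof -
  have sub: "S \<subseteq> Omega a b" if "S = {..<a} \<times> UNIV \<or> S = {a<..<b} \<times> UNIV \<or> S = {b<..} \<times> UNIV" for S
    using that ab by (auto simp: Omega_def)
  obtain uL where uL: "continuous_on UNIV uL" "\<And>z. z \<in> {..<a} \<times> UNIV \<Longrightarrow> uL z = u z"
  proof (rule continuous_extension_from_limits[of "{..<a} \<times> UNIV" u])
    fix x assume "x \<in> closure ({..<a} \<times> UNIV)" "x \<notin> {..<a} \<times> (UNIV :: real set)"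
    then obtain t where "x = (a, t)" by (cases x) (auto simp: closure_times_UNIV)
    then show "\<exists>l. (u \<longlongrightarrow> l) (at x within {..<a} \<times> UNIV)" using lim by (auto simp: left_of_def)
  qed (auto intro: open_Times continuous_on_subset[OF cont sub])
  obtain uR where uR: "continuous_on UNIV uR" "\<And>z. z \<in> {b<..} \<times> UNIV \<Longrightarrow> uR z = u z"
  proof (rule continuous_extension_from_limits[of "{b<..} \<times> UNIV" u])
    fix x assume "x \<in> closure ({b<..} \<times> UNIV)" "x \<notin> {b<..} \<times> (UNIV :: real set)"
    then obtain t where "x = (b, t)" by (cases x) (auto simp: closure_times_UNIV)
    then show "\<exists>l. (u \<longlongrightarrow> l) (at x within {b<..} \<times> UNIV)" using lim by (auto simp: right_of_def)
  qed (auto intro: open_Times continuous_on_subset[OF cont sub])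
  obtain uM where uM: "continuous_on UNIV uM" "\<And>z. z \<in> {a<..<b} \<times> UNIV \<Longrightarrow> uM z = u z"
  proof (rule continuous_extension_from_limits[of "{a<..<b} \<times> UNIV" u])
    fix x assume "x \<in> closure ({a<..<b} \<times> UNIV)" "x \<notin> {a<..<b} \<times> (UNIV :: real set)"
    then obtain t where x: "x = (a, t) \<or> x = (b, t)" using ab by (cases x) (force simp: closure_times_UNIV)
    \<comment> \<open>The limits are given along whole half-planes, and the middle strip is
      contained in both of them.\<close>
    obtain l1 l2 where "(u \<longlongrightarrow> l1) (at (a, t) within {a<..} \<times> UNIV)" "(u \<longlongrightarrow> l2) (at (b, t) within {..<b} \<times> UNIV)"
      using lim unfolding left_of_def right_of_def by blast
    then have "(u \<longlongrightarrow> l1) (at (a, t) within {a<..<b} \<times> UNIV)" "(u \<longlongrightarrow> l2) (at (b, t) within {a<..<b} \<times> UNIV)"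
      by (auto elim!: tendsto_within_subset)
    then show "\<exists>l. (u \<longlongrightarrow> l) (at x within {a<..<b} \<times> UNIV)" using x by auto
  qed (auto intro: open_Times continuous_on_subset[OF cont sub])
  show ?thesis
    by (intro exI[of _ uL] exI[of _ uM] exI[of _ uR]) (use uL uM uR in \<open>auto simp: strips_def\<close>)
qed

text \<open>\<open>U\<close> confines the comparison to the neighbouring strip: on the full
  half-plane \<open>S\<close> beyond it, \<open>u\<close> may follow another representative.\<close>

lemma Lim_one_sided:
  assumes "continuous_on UNIV v" "\<And>z. z \<in> U \<inter> S \<Longrightarrow> u z = v z" "open U" "x \<in> U" "at x within S \<noteq> bot"
  shows "Lim (at x within S) u = v x"
proof (rule tendsto_Lim[OF assms(5)])
  have "(v \<longlongrightarrow> v x) (at x within S)"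
    using assms(1) by (meson UNIV_I continuous_on_def tendsto_within_subset subset_UNIV)
  moreover have "\<forall>\<^sub>F z in at x within S. v z = u z"
    unfolding eventually_at_topological using assms by (intro exI[of _ U]) auto
  ultimately show "(u \<longlongrightarrow> v x) (at x within S)"
    by (rule Lim_transform_eventually)
qed

lemma one_sided_nontrivial:
  "at (r0, t0) within {..<r0} \<times> UNIV \<noteq> bot" "at (r0, t0) within {r0<..} \<times> UNIV \<noteq> bot" for r0 t0 :: real
proof -
  have "(r0, t0) islimpt S" if "(r0, t0) \<in> closure S" "(r0, t0) \<notin> S" for S
    using that by (auto simp: closure_def)
  then show "at (r0, t0) within {..<r0} \<times> UNIV \<noteq> bot" "at (r0, t0) within {r0<..} \<times> UNIV \<noteq> bot"
    by (auto simp: trivial_limit_within closure_times_UNIV)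
qed

lemma jump_strips:
  assumes "a < b" "strips a b u uL uM uR"
  shows "jump u a t = uM (a, t) - uL (a, t)" "jump u b t = uR (b, t) - uM (b, t)"
proof -
  have "Lim (right_of a t) u = uM (a, t)"
    unfolding right_of_def using assms one_sided_nontrivial
    by (intro Lim_one_sided[where U="{..<b} \<times> UNIV"]) (auto simp: strips_def intro: open_Times)
  moreover have "Lim (left_of b t) u = uM (b, t)"
    unfolding left_of_def using assms one_sided_nontrivial
    by (intro Lim_one_sided[where U="{a<..} \<times> UNIV"]) (auto simp: strips_def intro: open_Times)
  moreover have "Lim (left_of a t) u = uL (a, t)" "Lim (right_of b t) u = uR (b, t)"
    unfolding right_of_def left_of_def using assms one_sided_nontrivial
    by (auto intro!: Lim_one_sided[where U=UNIV] simp: strips_def)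
  ultimately show "jump u a t = uM (a, t) - uL (a, t)" "jump u b t = uR (b, t) - uM (b, t)"
    by (simp_all add: jump_def)
qed

section \<open>Integrals over the plane, split along the two lines\<close>

lemma negligible_vertical_line: "negligible {z :: real \<times> real. fst z = c}"
  using negligible_hyperplane[of "(1, 0) :: real \<times> real" c] by (simp add: inner_prod_def zero_prod_def)

text \<open>Off the two null lines \<open>w\<close> agrees on each box with a continuous function,
  so its values on the lines do not affect integrability or the integral. This also passes from the
  Lebesgue integral in \<open>dist_of\<close> to the gauge integral in Green's formula.\<close>

lemma strips_integral:
  assumes w: "strips a b w wL wM wR" and ab: "a < b" and R: "\<bar>a\<bar> < R" "\<bar>b\<bar> < R"
    and supp: "\<And>z. z \<notin> cbox (- R, - R) (R, R) \<Longrightarrow> w z = 0"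
  shows "integrable lebesgue w"
    and "(LINT z|lebesgue. w z) = integral UNIV w"
    and "integral UNIV w = integral (cbox (- R, - R) (a, R)) wL + integral (cbox (a, - R) (b, R)) wM
      + integral (cbox (b, - R) (R, R)) wR"
proof -
  let ?N = "{z :: real \<times> real. fst z = a} \<union> {z. fst z = b}"
  let ?L = "cbox (- R, - R) (a, R)" and ?M = "cbox (a, - R) (b, R)" and ?R = "cbox (b, - R) (R, R)"
  have N: "negligible ?N" by (intro negligible_Un negligible_vertical_line)
  have wL: "w z = wL z" if "z \<in> ?L - ?N" for z
    using that w by (cases z) (auto simp: strips_def cbox_Pair_eq)
  have wM: "w z = wM z" if "z \<in> ?M - ?N" for z
    using that w by (cases z) (auto simp: strips_def cbox_Pair_eq)
  have wR: "w z = wR z" if "z \<in> ?R - ?N" for z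
    using that w by (cases z) (auto simp: strips_def cbox_Pair_eq)
  have c: "continuous_on S wL" "continuous_on S wM" "continuous_on S wR" for S
    using w by (auto simp: strips_def intro: continuous_on_subset)
  have un: "?L \<union> ?M \<union> ?R = cbox (- R, - R) (R, R)" using ab R by (auto simp: cbox_Pair_eq)
  have "w absolutely_integrable_on ?L" "w absolutely_integrable_on ?M" "w absolutely_integrable_on ?R"
    by (rule absolutely_integrable_spike[OF absolutely_integrable_continuous[OF c(1)] N wL]
        absolutely_integrable_spike[OF absolutely_integrable_continuous[OF c(2)] N wM]
        absolutely_integrable_spike[OF absolutely_integrable_continuous[OF c(3)] N wR], assumption)+
  then have "w absolutely_integrable_on ?L \<union> ?M \<union> ?R" by (intro absolutely_integrable_Un)
  then have "(\<lambda>z. if z \<in> cbox (- R, - R) (R, R) then w z else 0) absolutely_integrable_on UNIV"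
    unfolding absolutely_integrable_restrict_UNIV un .
  moreover have weq: "(\<lambda>z. if z \<in> cbox (- R, - R) (R, R) then w z else 0) = w" using supp by auto
  ultimately have ai: "w absolutely_integrable_on UNIV" by simp
  then show "integrable lebesgue w" by (simp add: set_integrable_def)
  show "(LINT z|lebesgue. w z) = integral UNIV w"
    using set_lebesgue_integral_eq_integral(2)[OF ai] by (simp add: set_lebesgue_integral_def)
  have "(w has_integral integral ?L wL) ?L" "(w has_integral integral ?M wM) ?M" "(w has_integral integral ?R wR) ?R"
    by (rule has_integral_spike[OF N wL integrable_integral[OF integrable_continuous[OF c(1)]]]
        has_integral_spike[OF N wM integrable_integral[OF integrable_continuous[OF c(2)]]]
        has_integral_spike[OF N wR integrable_integral[OF integrable_continuous[OF c(3)]]], assumption)+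
  then have "(w has_integral integral ?L wL + integral ?M wM + integral ?R wR) (?L \<union> ?M \<union> ?R)"
    using ab by (intro has_integral_Un negligible_subset[OF N]) (auto simp: cbox_Pair_eq)
  then show "integral UNIV w = integral ?L wL + integral ?M wM + integral ?R wR"
    using has_integral_restrict_UNIV[of "cbox (- R, - R) (R, R)" w] unfolding un weq
    by (simp add: integral_unique)
qed

lemma lborel_integral_compact_support:
  fixes f :: "real \<Rightarrow> real"
  assumes "continuous_on UNIV f" "\<And>t. t \<notin> {c..d} \<Longrightarrow> f t = 0"
  shows "integrable lborel f" "(LINT t|lborel. f t) = integral {c..d} f"
proof -
  have f: "(\<lambda>t. indicator {c..d} t * f t) = f"
  proof
    show "indicator {c..d} t * f t = f t" for t
      using assms(2)[of t] by (cases "t \<in> {c..d}") auto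
  qed
  have int: "set_integrable lborel {c..d} f"
    using assms by (intro borel_integrable_atLeastAtMost') (auto intro: continuous_on_subset)
  then show "integrable lborel f" by (simp add: set_integrable_def f)
  show "(LINT t|lborel. f t) = integral {c..d} f"
    using set_borel_integral_eq_integral(2)[OF int] by (simp add: set_lebesgue_integral_def f)
qed

section \<open>Distributional equations and jump conditions\<close>

lemma weak_form:
  assumes ab: "a < b" and P: "strips a b P PL PM PR" and Q: "strips a b Q QL QM QR"
    and g: "strips a b g gL gM gR" and \<phi>: "test_function \<phi>"
    and R: "\<bar>a\<bar> < R" "\<bar>b\<bar> < R" "\<And>z. z \<notin> cbox (- R, - R) (R, R) \<Longrightarrow> \<phi> z = 0"
  shows "D_t (dist_of P) \<phi> + D_r (dist_of Q) \<phi> + dist_of g \<phi>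
      = - integral UNIV (\<lambda>z. P z * pd_t \<phi> z + Q z * pd_r \<phi> z - g z * \<phi> z)"
    and "integral UNIV (\<lambda>z. P z * pd_t \<phi> z + Q z * pd_r \<phi> z - g z * \<phi> z)
      = integral (cbox (- R, - R) (a, R)) (\<lambda>z. PL z * pd_t \<phi> z + QL z * pd_r \<phi> z - gL z * \<phi> z)
        + integral (cbox (a, - R) (b, R)) (\<lambda>z. PM z * pd_t \<phi> z + QM z * pd_r \<phi> z - gM z * \<phi> z)
        + integral (cbox (b, - R) (R, R)) (\<lambda>z. PR z * pd_t \<phi> z + QR z * pd_r \<phi> z - gR z * \<phi> z)"
proof -
  note T = test_function_C1(3-5)[OF \<phi>, of UNIV]
  note z = R(3) zero_outside_closed_partials[OF closed_cbox R(3)]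
  note sP = strips_mult[OF P strips_continuous[OF T(2)]]
  note sQ = strips_mult[OF Q strips_continuous[OF T(1)]]
  note sg = strips_mult[OF g strips_continuous[OF T(3)]]
  note w = strips_diff[OF strips_add[OF sP sQ] sg]
  have "integrable lebesgue (\<lambda>z. P z * pd_t \<phi> z)" "integrable lebesgue (\<lambda>z. Q z * pd_r \<phi> z)"
    "integrable lebesgue (\<lambda>z. g z * \<phi> z)"
    by (rule strips_integral(1)[OF sP ab R(1,2)] strips_integral(1)[OF sQ ab R(1,2)]
        strips_integral(1)[OF sg ab R(1,2)], simp add: z)+
  then have "D_t (dist_of P) \<phi> + D_r (dist_of Q) \<phi> + dist_of g \<phi>
      = - (LINT z|lebesgue. P z * pd_t \<phi> z + Q z * pd_r \<phi> z - g z * \<phi> z)"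
    by (simp add: D_t_def D_r_def dist_of_def)
  also have "(LINT z|lebesgue. P z * pd_t \<phi> z + Q z * pd_r \<phi> z - g z * \<phi> z)
      = integral UNIV (\<lambda>z. P z * pd_t \<phi> z + Q z * pd_r \<phi> z - g z * \<phi> z)"
    by (rule strips_integral(2)[OF w ab R(1,2)]) (simp add: z)
  finally show "D_t (dist_of P) \<phi> + D_r (dist_of Q) \<phi> + dist_of g \<phi>
      = - integral UNIV (\<lambda>z. P z * pd_t \<phi> z + Q z * pd_r \<phi> z - g z * \<phi> z)" .
  show "integral UNIV (\<lambda>z. P z * pd_t \<phi> z + Q z * pd_r \<phi> z - g z * \<phi> z)
      = integral (cbox (- R, - R) (a, R)) (\<lambda>z. PL z * pd_t \<phi> z + QL z * pd_r \<phi> z - gL z * \<phi> z)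
        + integral (cbox (a, - R) (b, R)) (\<lambda>z. PM z * pd_t \<phi> z + QM z * pd_r \<phi> z - gM z * \<phi> z)
        + integral (cbox (b, - R) (R, R)) (\<lambda>z. PR z * pd_t \<phi> z + QR z * pd_r \<phi> z - gR z * \<phi> z)"
    by (rule strips_integral(3)[OF w ab R(1,2)]) (simp add: z)
qed

lemma continuous_on_vertical_line:
  "continuous_on UNIV f \<Longrightarrow> continuous_on S (\<lambda>t. f (r, t))" for f :: "real \<times> real \<Rightarrow> real"
  by (rule continuous_on_compose2[of UNIV f]) (auto intro!: continuous_intros)

text \<open>Each line is the right edge of one strip and the left edge of the next, so its two
  traces enter with opposite signs; the minus sign in \<open>D_t\<close> and \<open>D_r\<close>
  orders them as right minus left. The edges at \<open>- R\<close> and \<open>R\<close> give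
  nothing, since \<open>\<phi>\<close> vanishes there.\<close>

lemma distributional_eq_jumps:
  assumes ab: "a < b" and P: "strips a b P PL PM PR" and Q: "strips a b Q QL QM QR"
    and g: "strips a b g gL gM gR"
    and diff: "\<And>z. z \<in> Omega a b \<Longrightarrow> differentiable_t P z \<and> differentiable_r Q z"
    and Qr: "continuous_on (Omega a b) (pd_r Q)"
    and pde: "\<And>z. z \<in> Omega a b \<Longrightarrow> pd_t P z + pd_r Q z + g z = 0"
    and \<phi>: "test_function \<phi>"
  shows "D_t (dist_of P) \<phi> + D_r (dist_of Q) \<phi> + dist_of g \<phi>
    = (\<Sum>r0\<in>{a, b}. LINT t|lborel. jump Q r0 t * \<phi> (r0, t))"
proof -
  obtain R where R: "R > max \<bar>a\<bar> \<bar>b\<bar>" and Rz: "\<And>z. z \<notin> cbox (- R, - R) (R, R) \<Longrightarrow> \<phi> z = 0"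
    and R0: "\<And>r t. \<bar>t\<bar> \<ge> R \<or> \<bar>r\<bar> \<ge> R \<Longrightarrow> \<phi> (r, t) = 0"
    using test_function_box[OF \<phi>] by metis
  let ?w = "\<lambda>P Q g z. P z * pd_t \<phi> z + Q z * pd_r \<phi> z - g z * \<phi> z"
  let ?B = "\<lambda>Q r. integral {- R..R} (\<lambda>t. Q (r, t) * \<phi> (r, t))"
  have strip: "integral (cbox (c, - R) (d, R)) (?w P' Q' g') = ?B Q' d - ?B Q' c"
    if cd: "c \<le> d" and eq: "\<And>r t. r \<in> {c<..<d} \<Longrightarrow>
        P (r, t) = P' (r, t) \<and> Q (r, t) = Q' (r, t) \<and> g (r, t) = g' (r, t)"
      and cont: "continuous_on UNIV P'" "continuous_on UNIV Q'" "continuous_on UNIV g'"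
      and sub: "{c<..<d} \<times> UNIV \<subseteq> Omega a b" for c d P' Q' g'
  proof (rule green_strip[where P=P and Q=Q and g=g])
    show "continuous_on ({c<..<d} \<times> UNIV) (pd_r Q)" by (rule continuous_on_subset[OF Qr sub])
    show "continuous_on ({c..d} \<times> UNIV) P'" "continuous_on ({c..d} \<times> UNIV) Q'"
      "continuous_on ({c..d} \<times> UNIV) g'"
      using cont by (meson continuous_on_subset subset_UNIV)+
    show "P (r, t) = P' (r, t) \<and> Q (r, t) = Q' (r, t) \<and> g (r, t) = g' (r, t)"
      if "r \<in> {c<..<d}" for r t using that by (rule eq)
    have "(r, t) \<in> Omega a b" if "r \<in> {c<..<d}" for r t using sub that by auto
    then show "differentiable_t P (r, t) \<and> differentiable_r Q (r, t)"
      "pd_t P (r, t) + pd_r Q (r, t) + g (r, t) = 0" if "r \<in> {c<..<d}" for r t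
      using diff pde that by blast+
  qed (use R R0 \<phi> cd in auto)
  have c: "continuous_on UNIV PL" "continuous_on UNIV PM" "continuous_on UNIV PR"
    "continuous_on UNIV QL" "continuous_on UNIV QM" "continuous_on UNIV QR"
    "continuous_on UNIV gL" "continuous_on UNIV gM" "continuous_on UNIV gR"
    using P Q g by (auto simp: strips_def)
  have L: "integral (cbox (- R, - R) (a, R)) (?w PL QL gL) = ?B QL a - ?B QL (- R)"
    by (rule strip) (use P Q g c R ab in \<open>auto simp: strips_def Omega_def\<close>)
  have M: "integral (cbox (a, - R) (b, R)) (?w PM QM gM) = ?B QM b - ?B QM a"
    by (rule strip) (use P Q g c R ab in \<open>auto simp: strips_def Omega_def\<close>)
  have Rt: "integral (cbox (b, - R) (R, R)) (?w PR QR gR) = ?B QR R - ?B QR b"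
    by (rule strip) (use P Q g c R ab in \<open>auto simp: strips_def Omega_def\<close>)
  have main: "D_t (dist_of P) \<phi> + D_r (dist_of Q) \<phi> + dist_of g \<phi> = (?B QM a - ?B QL a) + (?B QR b - ?B QM b)"
    using weak_form[where R=R, OF ab P Q g \<phi> _ _ Rz] R R0 by (simp add: L M Rt)
  have B: "?B Q2 r - ?B Q1 r = (LINT t|lborel. (Q2 (r, t) - Q1 (r, t)) * \<phi> (r, t))"
    if "continuous_on UNIV Q1" "continuous_on UNIV Q2" for Q1 Q2 r
  proof -
    note V = continuous_on_vertical_line[OF that(1)] continuous_on_vertical_line[OF that(2)]
      continuous_on_vertical_line[OF test_function_C1(5)[OF \<phi>]]
    have z: "\<phi> (r, t) = 0" if "t \<notin> {- R..R}" for t using that by (intro R0 disjI1) (auto simp: abs_if)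
    have "(LINT t|lborel. (Q2 (r, t) - Q1 (r, t)) * \<phi> (r, t))
        = integral {- R..R} (\<lambda>t. (Q2 (r, t) - Q1 (r, t)) * \<phi> (r, t))"
      by (intro lborel_integral_compact_support continuous_intros V) (simp add: z)
    also have "\<dots> = ?B Q2 r - ?B Q1 r"
      by (subst integral_diff[symmetric])
         (auto intro!: integrable_continuous_real continuous_intros V simp: algebra_simps)
    finally show ?thesis by simp
  qed
  show ?thesis
    unfolding main B[OF c(4,5)] B[OF c(5,6)] using ab by (simp add: jump_strips[OF ab Q])
qed

lemma jumps_from_weak:
  assumes ab: "a < b" and w: "\<And>r0. r0 \<in> {a, b} \<Longrightarrow> continuous_on UNIV (w r0)"
    and weak: "\<And>\<phi>. test_function \<phi> \<Longrightarrow> (\<Sum>r0\<in>{a, b}. LINT t|lborel. w r0 t * \<phi> (r0, t)) = 0"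
    and r0: "r0 \<in> {a, b}"
  shows "w r0 t0 = (0 :: real)"
proof (rule fundamental_lemma_real[where w = "w r0" and c = "t0 - 1" and d = "t0 + 1"])
  show "continuous_on {t0 - 1..t0 + 1} (w r0)" using w[OF r0] by (rule continuous_on_subset) simp
  fix e :: real assume e: "e > 0" "t0 - 1 < t0 - e" "t0 + e < t0 + 1"
  \<comment> \<open>The half-width \<open>b - a\<close> is the distance of the lines, so this
    function vanishes on the other line and only one term of the sum remains.\<close>
  define \<phi> where "\<phi> z = bump (b - a) r0 (fst z) * bump e t0 (snd z)" for z
  have test: "test_function \<phi>"
    unfolding \<phi>_def
    by (rule test_function_product[where c="r0 - (b - a)" and d="r0 + (b - a)" and R="\<bar>t0\<bar> + e"])
       (auto intro!: bump_Ck bump_zero)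
  obtain r1 where r1: "{a, b} = {r0, r1}" "r1 \<noteq> r0" "\<bar>r1 - r0\<bar> \<ge> b - a"
    using r0 ab that[of a] that[of b] by (auto simp: insert_commute)
  have "(LINT t|lborel. w r0 t * \<phi> (r0, t)) = 0"
    using weak[OF test] r1 by (simp add: \<phi>_def bump_zero)
  also have "(\<lambda>t. w r0 t * \<phi> (r0, t)) = (\<lambda>t. bump (b - a) r0 r0 * (w r0 t * bump e t0 t))"
    by (auto simp: \<phi>_def)
  finally have "(LINT t|lborel. w r0 t * bump e t0 t) = 0"
    using bump_pos[of r0 r0 "b - a"] ab by simp
  moreover have "(LINT t|lborel. w r0 t * bump e t0 t) = integral {t0 - 1..t0 + 1} (\<lambda>t. w r0 t * bump e t0 t)"
  proof (rule lborel_integral_compact_support(2))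
    show "w r0 t * bump e t0 t = 0" if "t \<notin> {t0 - 1..t0 + 1}" for t
      using that e bump_zero[of e t t0] by auto
  qed (intro continuous_intros w[OF r0] bump_continuous)
  ultimately show "integral {t0 - 1..t0 + 1} (\<lambda>t. w r0 t * bump e t0 t) = 0" by simp
qed auto

text \<open>Hiding the representatives lets \<open>n s\<close>, \<open>J s\<close> and the nonlinear
  terms be treated alike by closure rules.\<close>

definition piecewise_continuous where
  "piecewise_continuous a b u \<longleftrightarrow> (\<exists>uL uM uR. strips a b u uL uM uR)"

text \<open>From weak to classical the order matters: Green's identity for arbitrary
  \<open>\<phi>\<close> presupposes the equation off the lines. That equation is derived from test
  functions supported in one strip, which \<open>times_dV\<close> does not see; only then can the
  jumps be isolated.\<close>

lemma distributional_iff_classical: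
  assumes ab: "a < b" and P: "piecewise_continuous a b P" and Q: "piecewise_continuous a b Q"
    and g: "piecewise_continuous a b g"
    and Qdiff: "\<forall>z\<in>Omega a b. differentiable_r Q z" and Qr: "continuous_on (Omega a b) (pd_r Q)"
    and N: "continuous_on UNIV N"
  shows "(\<forall>\<phi>. test_function \<phi> \<longrightarrow>
        D_t (dist_of P) \<phi> + D_r (dist_of Q) \<phi> + dist_of g \<phi> + times_dV a b V0 N \<phi> = 0) \<longleftrightarrow>
      (\<forall>z\<in>Omega a b. differentiable_t P z \<and> pd_t P z + pd_r Q z + g z = 0) \<and>
      (\<forall>r0\<in>{a, b}. \<forall>t. jump Q r0 t + N (r0, t) * jump_pot (barrier a b V0) r0 = 0)"
    (is "?weak \<longleftrightarrow> ?classical \<and> ?jumps")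
proof -
  obtain PL PM PR QL QM QR gL gM gR where s: "strips a b P PL PM PR" "strips a b Q QL QM QR"
    "strips a b g gL gM gR"
    using P Q g by (auto simp: piecewise_continuous_def)
  have green: "D_t (dist_of P) \<phi> + D_r (dist_of Q) \<phi> + dist_of g \<phi>
      = (\<Sum>r0\<in>{a, b}. LINT t|lborel. jump Q r0 t * \<phi> (r0, t))"
    if ?classical "test_function \<phi>" for \<phi>
    by (rule distributional_eq_jumps[OF ab s]) (use that Qdiff Qr in auto)
  show ?thesis
  proof (intro iffI conjI)
    assume "?classical \<and> ?jumps"
    then have cl: ?classical and "\<And>r0 t. r0 \<in> {a, b} \<Longrightarrow>
        jump Q r0 t = - jump_pot (barrier a b V0) r0 * N (r0, t)"
      by (auto simp: eq_neg_iff_add_eq_0 mult.commute)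
    then have "(\<Sum>r0\<in>{a, b}. LINT t|lborel. jump Q r0 t * \<phi> (r0, t)) = - times_dV a b V0 N \<phi>" for \<phi>
      by (simp add: times_dV_def sum_negf[symmetric] mult.assoc)
    then show ?weak using green[OF cl] by simp
  next
    assume weak: ?weak
    have local: "integral UNIV (\<lambda>z. P z * pd_t \<phi> z + Q z * pd_r \<phi> z - g z * \<phi> z) = 0"
      if \<phi>: "test_function \<phi>" and supp: "\<And>r t. r \<notin> {c<..<d} \<Longrightarrow> \<phi> (r, t) = 0"
        and cd: "{c<..<d} \<inter> {a, b} = {}" for \<phi> c d
    proof -
      obtain R where R: "R > max \<bar>a\<bar> \<bar>b\<bar>" "\<And>z. z \<notin> cbox (- R, - R) (R, R) \<Longrightarrow> \<phi> z = 0"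
        using test_function_box[OF \<phi>] by metis
      have "\<phi> (a, t) = 0" "\<phi> (b, t) = 0" for t using supp cd by blast+
      then have "times_dV a b V0 N \<phi> = 0" using ab by (simp add: times_dV_def)
      then show ?thesis using weak \<phi> weak_form(1)[OF ab s \<phi> _ _ R(2)] R(1) by auto
    qed
    have loc: "differentiable_t P (r, t) \<and> pd_t P (r, t) + pd_r Q (r, t) + g (r, t) = 0"
      if "r \<in> {c<..<d}" "{c<..<d} \<inter> {a, b} = {}"
        "\<And>r t. r \<in> {c<..<d} \<Longrightarrow> P (r, t) = P' (r, t) \<and> Q (r, t) = Q' (r, t) \<and> g (r, t) = g' (r, t)"
        "continuous_on UNIV P'" "continuous_on UNIV Q'" "continuous_on UNIV g'" for r t c d P' Q' g'
    proof (rule local_classical[OF that(4-6,3)])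
      have sub: "{c<..<d} \<times> UNIV \<subseteq> Omega a b" using that(2) by (auto simp: Omega_def)
      show "differentiable_r Q (r, t)" if "r \<in> {c<..<d}" for r t
        using Qdiff subsetD[OF sub, of "(r, t)"] that by auto
      show "continuous_on ({c<..<d} \<times> UNIV) (pd_r Q)" by (rule continuous_on_subset[OF Qr sub])
        show "integral UNIV (\<lambda>z. P z * pd_t \<phi> z + Q z * pd_r \<phi> z - g z * \<phi> z) = 0"
        if "test_function \<phi>" "\<And>r t. r \<notin> {c<..<d} \<Longrightarrow> \<phi> (r, t) = 0" for \<phi>
        by (rule local[OF that \<open>{c<..<d} \<inter> {a, b} = {}\<close>])
    qed (use \<open>r \<in> {c<..<d}\<close> in auto)
    show cl: ?classical
    proof
      fix z assume z: "z \<in> Omega a b"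
      obtain r t where rt: "z = (r, t)" by fastforce
      consider "r < a" | "a < r" "r < b" | "b < r" using z by (force simp: rt Omega_def)
      then show "differentiable_t P z \<and> pd_t P z + pd_r Q z + g z = 0"
      proof cases
        case 1
        \<comment> \<open>The outer strips are unbounded; a bounded interval around
          \<open>r\<close>, reaching 1 beyond it, serves instead.\<close>
        show ?thesis unfolding rt
          by (rule loc[of r "r - 1" a PL QL gL]) (use 1 s ab in \<open>auto simp: strips_def\<close>)
      next
        case 2
        show ?thesis unfolding rt
          by (rule loc[of r a b PM QM gM]) (use 2 s ab in \<open>auto simp: strips_def\<close>)
      next
        case 3
        show ?thesis unfolding rt
          by (rule loc[of r b "r + 1" PR QR gR]) (use 3 s ab in \<open>auto simp: strips_def\<close>)
      qed
    qed
    \<comment> \<open>With the classical equation at hand, the weak one says exactly that the line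
      integrals of \<open>w r0 t * \<phi> (r0, t)\<close> add up to zero.\<close>
    define w where "w r0 t = jump Q r0 t + N (r0, t) * jump_pot (barrier a b V0) r0" for r0 t
    have contj: "continuous_on UNIV (jump Q r0)" if "r0 \<in> {a, b}" for r0
      using that s(2) ab
      by (auto simp: jump_strips[OF ab s(2), abs_def] strips_def
          intro!: continuous_intros continuous_on_vertical_line)
    have contw: "continuous_on UNIV (w r0)" if "r0 \<in> {a, b}" for r0
      unfolding w_def by (intro continuous_intros contj that continuous_on_vertical_line N)
    have "w r0 t = 0" if "r0 \<in> {a, b}" for r0 t
    proof (rule jumps_from_weak[OF ab contw _ that])
      fix \<phi> assume \<phi>: "test_function \<phi>"
      obtain R where R: "R > 0" "\<And>r t. \<bar>t\<bar> \<ge> R \<or> \<bar>r\<bar> \<ge> R \<Longrightarrow> \<phi> (r, t) = 0"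
        using test_function_box[OF \<phi>] by metis
      then have z: "\<phi> (r, t) = 0" if "t \<notin> {- R..R}" for r t
        using that by (intro R(2) disjI1) (auto simp: abs_if)
      note V = continuous_on_vertical_line[OF test_function_C1(5)[OF \<phi>]] continuous_on_vertical_line[OF N]
      have "(LINT t|lborel. w r0 t * \<phi> (r0, t)) = (LINT t|lborel. jump Q r0 t * \<phi> (r0, t))
          + jump_pot (barrier a b V0) r0 * (LINT t|lborel. N (r0, t) * \<phi> (r0, t))"
        if r0: "r0 \<in> {a, b}" for r0
      proof -
        have "integrable lborel (\<lambda>t. jump Q r0 t * \<phi> (r0, t))" "integrable lborel (\<lambda>t. N (r0, t) * \<phi> (r0, t))"
          by (auto intro!: lborel_integral_compact_support(1)[where c="-R" and d=R]
              continuous_intros contj r0 V z)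
        then have "(LINT t|lborel. jump Q r0 t * \<phi> (r0, t) +
              jump_pot (barrier a b V0) r0 * (N (r0, t) * \<phi> (r0, t)))
            = (LINT t|lborel. jump Q r0 t * \<phi> (r0, t))
          + jump_pot (barrier a b V0) r0 * (LINT t|lborel. N (r0, t) * \<phi> (r0, t))"
          by simp
        then show ?thesis by (simp add: w_def algebra_simps)
      qed
      then have "(\<Sum>r0\<in>{a, b}. LINT t|lborel. w r0 t * \<phi> (r0, t))
          = (\<Sum>r0\<in>{a, b}. LINT t|lborel. jump Q r0 t * \<phi> (r0, t)) + times_dV a b V0 N \<phi>"
        by (simp add: times_dV_def sum.distrib del: sum.insert)
      also have "\<dots> = 0"
        unfolding green[OF cl \<phi>, symmetric] using weak \<phi> by blast
      finally show "(\<Sum>r0\<in>{a, b}. LINT t|lborel. w r0 t * \<phi> (r0, t)) = 0" .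
    qed
    then show ?jumps by (simp add: w_def)
  qed
qed

section \<open>Closure rules, constant coefficients, and the eight equations of the system\<close>

lemma piecewise_continuous_intros:
  "continuous_on UNIV u \<Longrightarrow> piecewise_continuous a b u"
  "piecewise_continuous a b u \<Longrightarrow> piecewise_continuous a b v \<Longrightarrow> piecewise_continuous a b (\<lambda>z. u z + v z)"
  "piecewise_continuous a b u \<Longrightarrow> piecewise_continuous a b v \<Longrightarrow> piecewise_continuous a b (\<lambda>z. u z - v z)"
  "piecewise_continuous a b u \<Longrightarrow> piecewise_continuous a b v \<Longrightarrow> piecewise_continuous a b (\<lambda>z. u z * v z)"
  unfolding piecewise_continuous_def
  by (blast intro: strips_continuous strips_add strips_diff strips_mult)+

lemma jump_continuous: "a < b \<Longrightarrow> continuous_on UNIV u \<Longrightarrow> r0 \<in> {a, b} \<Longrightarrow> jump u r0 t = 0"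
  using jump_strips[OF _ strips_continuous] by auto

text \<open>The constants are absorbed into \<open>Q\<close> and \<open>g\<close>. Taking
  \<open>c = 0\<close> or \<open>k = 0\<close> switches a term off, and a negative \<open>k\<close>
  supplies the minus signs of the system.\<close>

lemma distributional_iff_classical_scaled:
  assumes ab: "a < b" and P: "piecewise_continuous a b P" and Q: "piecewise_continuous a b Q"
    and g: "piecewise_continuous a b g"
    and Qdiff: "\<forall>z\<in>Omega a b. differentiable_r Q z" and Qr: "continuous_on (Omega a b) (pd_r Q)"
    and N: "continuous_on UNIV N"
  shows "(\<forall>\<phi>. test_function \<phi> \<longrightarrow>
        D_t (dist_of P) \<phi> + c * D_r (dist_of Q) \<phi> + k * dist_of g \<phi> + times_dV a b V0 N \<phi> = 0) \<longleftrightarrow>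
      (\<forall>z\<in>Omega a b. differentiable_t P z \<and> pd_t P z + c * pd_r Q z + k * g z = 0) \<and>
      (\<forall>r0\<in>{a, b}. \<forall>t. c * jump Q r0 t + N (r0, t) * jump_pot (barrier a b V0) r0 = 0)"
proof -
  let ?Q = "\<lambda>z. c * Q z" and ?g = "\<lambda>z. k * g z"
  have dQ: "((\<lambda>r. ?Q (r, t)) has_real_derivative c * pd_r Q (r, t)) (at r)" if "(r, t) \<in> Omega a b" for r t
    using differentiable_rD that Qdiff by (intro DERIV_cmult) auto
  have pd: "pd_r ?Q z = c * pd_r Q z" if "z \<in> Omega a b" for z
    using pd_r_eqI[OF dQ] that by (cases z) auto
  have 1: "\<forall>z\<in>Omega a b. differentiable_r ?Q z"
    using differentiable_rI[OF dQ] by auto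
  have 2: "continuous_on (Omega a b) (pd_r ?Q)"
    using continuous_on_mult_left[OF Qr, of c] by (simp add: pd cong: continuous_on_cong)
  have pcQ: "piecewise_continuous a b ?Q" "piecewise_continuous a b ?g"
    by (intro piecewise_continuous_intros(4) Q g piecewise_continuous_intros(1) continuous_on_const)+
  obtain QL QM QR where s: "strips a b Q QL QM QR" using Q by (auto simp: piecewise_continuous_def)
  have jmp: "jump ?Q r0 t = c * jump Q r0 t" if "r0 \<in> {a, b}" for r0 t
    using that
    by (auto simp: jump_strips[OF ab s] right_diff_distrib
        jump_strips[OF ab strips_mult[OF strips_continuous[OF continuous_on_const] s]])
  have D: "D_r (dist_of ?Q) \<phi> = c * D_r (dist_of Q) \<phi>" "dist_of ?g \<phi> = k * dist_of g \<phi>" for \<phi>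
    by (simp_all add: D_r_def dist_of_def mult.assoc)
  show ?thesis
    using distributional_iff_classical[OF ab P pcQ 1 2 N, of V0] by (simp add: D jmp pd)
qed

theorem theorem11:
  fixes vF hbar m \<theta> a b V0 :: real
    and n J :: "nat \<Rightarrow> real \<times> real \<Rightarrow> real"
  assumes "vF > 0" and "hbar > 0" and "m > 0" and "\<theta> > 0"
    and "a < b" and "V0 \<noteq> 0"
    and "piecewise_regular a b n J"
    and "\<forall>z. n 0 z > 0"
  shows "distributional_QFDE vF hbar m \<theta> a b V0 n J \<longleftrightarrow>
    classical_QFDE vF hbar m \<theta> (\<lambda>_. 0) (Omega a b) n J
    \<and> (\<forall>r0\<in>{a, b}. \<forall>t.
          vF * jump (J 1) r0 t + n 0 (r0, t) * jump_pot (barrier a b V0) r0 = 0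
        \<and> vF * jump (J 0) r0 t + n 1 (r0, t) * jump_pot (barrier a b V0) r0 = 0
        \<and> n 2 (r0, t) = 0 \<and> n 3 (r0, t) = 0)"
proof -
  let ?S = "{0, 1, 2, 3} :: nat set"
  let ?j = "jump_pot (barrier a b V0)"
  have n: "continuous_on UNIV (n s)" "\<forall>z\<in>Omega a b. differentiable_r (n s) z"
    "continuous_on (Omega a b) (pd_r (n s))" and J: "J s \<in> space_X a b" if "s \<in> ?S" for s
    using assms(7) that Ck_on_1_partials(5)[of "Omega a b" "pd_r (n s)"]
    unfolding piecewise_regular_def by (auto simp: space_X_def simp del: Ck_on.simps)
  have JC: "Ck_on 1 (Omega a b) (J s)" if "s \<in> ?S" for s
    using J[OF that] by (simp add: space_X_def del: Ck_on.simps)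
  note Jd = Ck_on_1_partials[OF JC]
  have pJ: "piecewise_continuous a b (J s)" if "s \<in> ?S" for s
    using strips_of_limits[OF assms(5) Jd(5)[OF that]] J[OF that]
    by (auto simp: space_X_def piecewise_continuous_def)
  have pn: "piecewise_continuous a b (n s)" if "s \<in> ?S" for s
    by (rule piecewise_continuous_intros(1)[OF n(1)[OF that]])
  have p0: "piecewise_continuous a b (\<lambda>_. 0)"
    by (intro piecewise_continuous_intros continuous_on_const)
  \<comment> \<open>The nonlinear bracket. Only \<open>G 2\<close> and \<open>G 3\<close> occur in
    the system; the conditional pairs \<open>n 3\<close> with \<open>J 3\<close> and sends every
    other index to \<open>J 2\<close>.\<close>
  define G where "G s z = (m * \<theta> - (J 0 z)\<^sup>2 / (n 0 z)\<^sup>2) * n s z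
    + 2 / n 0 z * J 0 z * J (if s = 3 then 3 else 2) z" for s z
  have n0: "n 0 z \<noteq> 0" for z using assms(8) by (metis less_irrefl)
  have pG: "piecewise_continuous a b (G s)" if "s \<in> ?S" for s
  proof -
    \<comment> \<open>The closure rules cover sums, differences and products, so the quotient
      becomes a product with \<open>1 / (n 0 z)\<^sup>2\<close>, continuous because
      \<open>n 0\<close> has no zero.\<close>
    have "G s = (\<lambda>z. (m * \<theta> - (J 0 z * J 0 z) * (1 / (n 0 z)\<^sup>2)) * n s z
        + 2 / n 0 z * J 0 z * J (if s = 3 then 3 else 2) z)"
      by (auto simp: G_def power2_eq_square)
    moreover have "piecewise_continuous a b \<dots>"
      by (intro piecewise_continuous_intros(2-4) pJ pn piecewise_continuous_intros(1) continuous_intros n)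
         (use that n0 in auto)
    ultimately show ?thesis by simp
  qed
  note iff = distributional_iff_classical_scaled[OF assms(5), of _ _ _ _ _ _ V0]
  have j: "?j r0 \<noteq> 0" if "r0 \<in> {a, b}" for r0
    using that assms(5,6) jump_pot_barrier[OF assms(5)] by auto
  have zero: "times_dV a b V0 (\<lambda>_. 0) \<phi> = 0" for \<phi> using assms(5) by (simp add: times_dV_def)
  have zd: "\<forall>z\<in>Omega a b. differentiable_r (\<lambda>_. 0) z" "continuous_on (Omega a b) (pd_r (\<lambda>_. 0))"
    by (simp_all add: differentiable_r_def pd_r_def[abs_def])
  \<comment> \<open>Here \<open>Q\<close> is continuous and \<open>N = 0\<close>, so both terms of
    the jump condition vanish.\<close>
  have transport_n: "(\<forall>\<phi>. test_function \<phi> \<longrightarrow> D_t (dist_of (n s)) \<phi> + vF * D_r (dist_of (n s')) \<phi> = 0) \<longleftrightarrow>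
      (\<forall>z\<in>Omega a b. differentiable_t (n s) z \<and> pd_t (n s) z + vF * pd_r (n s') z = 0)"
    if "s \<in> ?S" "s' \<in> ?S" for s s'
    using iff[OF pn[OF that(1)] pn[OF that(2)] p0 n(2,3)[OF that(2)] continuous_on_const[of _ 0], of vF 0]
    by (simp add: zero jump_continuous[OF assms(5) n(1)[OF that(2)]])
  have local_n: "(\<forall>\<phi>. test_function \<phi> \<longrightarrow> D_t (dist_of (n s)) \<phi> + k * dist_of (J s') \<phi> = 0) \<longleftrightarrow>
      (\<forall>z\<in>Omega a b. differentiable_t (n s) z \<and> pd_t (n s) z + k * J s' z = 0)"
    if "s \<in> ?S" "s' \<in> ?S" for s s' k
    using iff[OF pn[OF that(1)] p0 pJ[OF that(2)] zd continuous_on_const[of _ 0], of 0 k]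
    by (simp add: zero)
  \<comment> \<open>Differentiability of \<open>J s\<close> in \<open>t\<close> is part of
    membership in \<open>space_X\<close>, so it is absent on the right.\<close>
  have transport_J: "(\<forall>\<phi>. test_function \<phi> \<longrightarrow>
        D_t (dist_of (J s)) \<phi> + vF * D_r (dist_of (J s')) \<phi> + times_dV a b V0 (n s) \<phi> = 0) \<longleftrightarrow>
      (\<forall>z\<in>Omega a b. pd_t (J s) z + vF * pd_r (J s') z = 0) \<and>
      (\<forall>r0\<in>{a, b}. \<forall>t. vF * jump (J s') r0 t + n s (r0, t) * ?j r0 = 0)"
    if "s \<in> ?S" "s' \<in> ?S" for s s'
    using iff[OF pJ[OF that(1)] pJ[OF that(2)] p0 Jd(1,3)[OF that(2)] n(1)[OF that(1)], of vF 0]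
      Jd(2)[OF that(1)] by simp
  \<comment> \<open>With no \<open>r\<close>-derivative the jump condition reads
    \<open>n s (r0, t) * ?j r0 = 0\<close>, and \<open>?j r0\<close> is \<open>V0\<close> or
    \<open>- V0\<close>, hence nonzero.\<close>
  have local_J: "(\<forall>\<phi>. test_function \<phi> \<longrightarrow>
        D_t (dist_of (J s)) \<phi> + k * dist_of (G s') \<phi> + times_dV a b V0 (n s) \<phi> = 0) \<longleftrightarrow>
      (\<forall>z\<in>Omega a b. pd_t (J s) z + k * G s' z = 0) \<and>
      (\<forall>r0\<in>{a, b}. \<forall>t. n s (r0, t) = 0)"
    if "s \<in> ?S" "s' \<in> ?S" for s s' k
    using iff[OF pJ[OF that(1)] p0 pG[OF that(2)] zd n(1)[OF that(1)], of 0 k]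
      Jd(2)[OF that(1)] j by simp
  have G: "G 2 = (\<lambda>z. (m * \<theta> - (J 0 z)\<^sup>2 / (n 0 z)\<^sup>2) * n 2 z + 2 / n 0 z * J 0 z * J 2 z)"
    "G 3 = (\<lambda>z. (m * \<theta> - (J 0 z)\<^sup>2 / (n 0 z)\<^sup>2) * n 3 z + 2 / n 0 z * J 0 z * J 3 z)"
    by (auto simp: G_def)
  define K where "K = 2 * vF / hbar"
  have S: "0 \<in> ?S" "1 \<in> ?S" "2 \<in> ?S" "3 \<in> ?S" by simp_all
  note eqs = transport_n[OF S(1,2)] transport_n[OF S(2,1)] local_n[OF S(3,4)] local_n[OF S(4,3)]
    transport_J[OF S(1,2)] transport_J[OF S(2,1)] local_J[OF S(3,4)] local_J[OF S(4,3)]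
  have "distributional_QFDE vF hbar m \<theta> a b V0 n J \<longleftrightarrow>
      (\<forall>\<phi>. test_function \<phi> \<longrightarrow> D_t (dist_of (n 0)) \<phi> + vF * D_r (dist_of (n 1)) \<phi> = 0) \<and>
      (\<forall>\<phi>. test_function \<phi> \<longrightarrow> D_t (dist_of (n 1)) \<phi> + vF * D_r (dist_of (n 0)) \<phi> = 0) \<and>
      (\<forall>\<phi>. test_function \<phi> \<longrightarrow> D_t (dist_of (n 2)) \<phi> + K * dist_of (J 3) \<phi> = 0) \<and>
      (\<forall>\<phi>. test_function \<phi> \<longrightarrow> D_t (dist_of (n 3)) \<phi> + - K * dist_of (J 2) \<phi> = 0) \<and>
      (\<forall>\<phi>. test_function \<phi> \<longrightarrow>
        D_t (dist_of (J 0)) \<phi> + vF * D_r (dist_of (J 1)) \<phi> + times_dV a b V0 (n 0) \<phi> = 0) \<and>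
      (\<forall>\<phi>. test_function \<phi> \<longrightarrow>
        D_t (dist_of (J 1)) \<phi> + vF * D_r (dist_of (J 0)) \<phi> + times_dV a b V0 (n 1) \<phi> = 0) \<and>
      (\<forall>\<phi>. test_function \<phi> \<longrightarrow>
        D_t (dist_of (J 2)) \<phi> + K * dist_of (G 3) \<phi> + times_dV a b V0 (n 2) \<phi> = 0) \<and>
      (\<forall>\<phi>. test_function \<phi> \<longrightarrow>
        D_t (dist_of (J 3)) \<phi> + - K * dist_of (G 2) \<phi> + times_dV a b V0 (n 3) \<phi> = 0)"
    unfolding distributional_QFDE_def G K_def[symmetric] diff_conv_add_uminus mult_minus_left by blast
  moreover have "classical_QFDE vF hbar m \<theta> (\<lambda>_. 0) (Omega a b) n J \<longleftrightarrow>
      (\<forall>z\<in>Omega a b. differentiable_t (n 0) z \<and> pd_t (n 0) z + vF * pd_r (n 1) z = 0) \<and>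
      (\<forall>z\<in>Omega a b. differentiable_t (n 1) z \<and> pd_t (n 1) z + vF * pd_r (n 0) z = 0) \<and>
      (\<forall>z\<in>Omega a b. differentiable_t (n 2) z \<and> pd_t (n 2) z + K * J 3 z = 0) \<and>
      (\<forall>z\<in>Omega a b. differentiable_t (n 3) z \<and> pd_t (n 3) z + - K * J 2 z = 0) \<and>
      (\<forall>z\<in>Omega a b. pd_t (J 0) z + vF * pd_r (J 1) z = 0) \<and>
      (\<forall>z\<in>Omega a b. pd_t (J 1) z + vF * pd_r (J 0) z = 0) \<and>
      (\<forall>z\<in>Omega a b. pd_t (J 2) z + K * G 3 z = 0) \<and>
      (\<forall>z\<in>Omega a b. pd_t (J 3) z + - K * G 2 z = 0)"
    unfolding classical_QFDE_def G K_def[symmetric] ball_conj_distrib[symmetric]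
  proof (rule ball_cong[OF refl], goal_cases)
    case (1 z)
    \<comment> \<open>Piecewise regularity gives these parts of \<open>classical_QFDE\<close>; what
      remains to be compared are the equations and the differentiability of the \<open>n s\<close>
      in \<open>t\<close>.\<close>
    then have "differentiable_r (n s) z" "differentiable_r (J s) z" "differentiable_t (J s) z" if "s \<in> ?S" for s
      using n(2)[OF that] Jd(1,2)[OF that] by blast+
    then show ?case by (simp add: conj_ac)
  qed
  ultimately show ?thesis
    unfolding eqs ball_conj_distrib all_conj_distrib by (simp only: conj_ac)
qed

end
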